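(* Let $A$ be a nonsingular $n\times n$ matrix (real or complex), and let $\mathcal{U}$ and $\mathcal{V}$ be semi-Parker random butterfly transforms (RBTs) of size $n$ and depth $\lceil \log_2 n\rceil + 1$. Then, with probability $1$, the matrix $\mathcal{U}^T A\,\mathcal{V}$ is strongly nonsingular.
   Context: A square matrix is strongly nonsingular if every leading principal submatrix (rows and columns $1,\dots,k$, for $1\le k\le n$) is nonsingular. Butterfly matrices: for integers $\mu,\nu\ge 0$ with $2\mu+\nu=m\ge 1$, the (orthogonal, generalized) butterfly matrix of size $m$ is $$O^{\langle m\rangle}_{\mu,\nu}=\begin{bmatrix}\tfrac{1}{\sqrt2}I_\mu&0&\tfrac1{\sqrt2}I_\mu\\0&I_\nu&0\\\tfrac1{\sqrt2}I_\mu&0&-\tfrac1{\sqrt2}I_\mu\end{bmatrix}.$$ It is called a Parker butterfly if $\nu=0$ or $m=1$ (when $m=1$, $\mu=0$, $\nu=1$ and the matrix is $[1]$). RBT: a depth-$d$ RBT of size $n$ is a product $$\mathcal{U}=D_dR_d\,D_{d-1}R_{d-1}\cdots D_1R_1,$$ where each $R_i$ is an $n\times n$ random diagonal matrix and each $D_i=\mathrm{diag}(O^{\langle \ell_{i,1}\rangle}_{\mu_{i,1},\nu_{i,1}},O^{\langle \ell_{i,2}\rangle}_{\mu_{i,2},\nu_{i,2}},\dots)$ is a block-diagonal matrix of butterfly matrices (layer $i$), with sizes aligned as follows. Layer $1$ consists of a single butterfly of size $n$. The list of block sizes of layer $i+1$ is obtained from that of layer $i$ by replacing, in order, each block of size $\ell=2\mu+\nu$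 with parameters $(\mu,\nu)$ by two consecutive blocks, the first of size $\mu+\nu$ and the second of size $\mu$ (blocks of size $0$ are omitted). The RBT is semi-Parker if, in each layer $D_i$, every butterfly except possibly the last one is a Parker butterfly. A semi-Parker RBT of depth $\lceil\log_2 n\rceil+1$ is understood to be full-depth: all blocks in the final layer $D_d$ have size $1$ (so $D_d=I_n$). Randomness: all the diagonal entries of all the matrices $R_i$ occurring in $\mathcal{U}$ and $\mathcal{V}$ are mutually independent real random variables, each with a continuous distribution (every single value has probability $0$). *)

theory Defs
  imports
    "HOL-Probability.Probability"
    "Jordan_Normal_Form.Matrix"
    "Jordan_Normal_Form.DL_Submatrix"
begin

definition strongly_nonsingular :: "'a::semiring_1 mat \<Rightarrow> bool" where
  "strongly_nonsingular A \<longleftrightarrow>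
     square_mat A \<and> (\<forall>k\<in>{1..dim_row A}. invertible_mat (submatrix A {..<k} {..<k}))"

definition butterfly_size :: "nat \<times> nat \<Rightarrow> nat" where
  "butterfly_size = (\<lambda>(\<mu>, \<nu>). 2 * \<mu> + \<nu>)"

(* The three cases for the row index i are the three block rows. *)
definition butterfly :: "nat \<times> nat \<Rightarrow> 'a::real_field mat" where
  "butterfly = (\<lambda>(\<mu>, \<nu>). Matrix.mat (2 * \<mu> + \<nu>) (2 * \<mu> + \<nu>) (\<lambda>(i, j).
     if i < \<mu> then (if j = i \<or> j = i + (\<mu> + \<nu>) then of_real (1 / sqrt 2) else 0)
     else if i < \<mu> + \<nu> then (if j = i then 1 else 0)
     else (if i = j + (\<mu> + \<nu>) then of_real (1 / sqrt 2)
           else if j = i then - of_real (1 / sqrt 2) else 0)))"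

definition parker :: "nat \<times> nat \<Rightarrow> bool" where
  "parker = (\<lambda>(\<mu>, \<nu>). \<nu> = 0 \<or> 2 * \<mu> + \<nu> = 1)"

definition child_sizes :: "nat \<times> nat \<Rightarrow> nat list" where
  "child_sizes = (\<lambda>(\<mu>, \<nu>). filter (\<lambda>m. m \<noteq> 0) [\<mu> + \<nu>, \<mu>])"

(* A layout records the parameters of all butterflies of an RBT: entry i is the list of the pairs
   (\<mu>, \<nu>) of layer i + 1, from the top left to the bottom right block. *)
definition rbt_layout :: "nat \<Rightarrow> (nat \<times> nat) list list \<Rightarrow> bool" where
  "rbt_layout n Ls \<longleftrightarrow>
     Ls \<noteq> [] \<and> map butterfly_size (hd Ls) = [n] \<and>
     (\<forall>i. Suc i < length Ls \<longrightarrow>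
        map butterfly_size (Ls ! Suc i) = concat (map child_sizes (Ls ! i)))"

definition semi_parker :: "(nat \<times> nat) list list \<Rightarrow> bool" where
  "semi_parker Ls \<longleftrightarrow> (\<forall>L\<in>set Ls. \<forall>b\<in>set (butlast L). parker b)"

definition full_depth :: "(nat \<times> nat) list list \<Rightarrow> bool" where
  "full_depth Ls \<longleftrightarrow> (\<forall>b\<in>set (last Ls). butterfly_size b = 1)"

(* The product of the first l layers; r i j is the j-th diagonal entry of the diagonal factor of
   layer i + 1, with j counted from 0. *)
primrec rbt_prod :: "nat \<Rightarrow> (nat \<times> nat) list list \<Rightarrow> (nat \<Rightarrow> nat \<Rightarrow> real) \<Rightarrow> nat \<Rightarrow> 'a::real_field mat" where
  "rbt_prod n Ls r 0 = 1\<^sub>m n"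
| "rbt_prod n Ls r (Suc l) =
     diag_block_mat (map butterfly (Ls ! l)) * mat_diag n (\<lambda>j. of_real (r l j)) * rbt_prod n Ls r l"

definition rbt :: "nat \<Rightarrow> (nat \<times> nat) list list \<Rightarrow> (nat \<Rightarrow> nat \<Rightarrow> real) \<Rightarrow> 'a::real_field mat" where
  "rbt n Ls r = rbt_prod n Ls r (length Ls)"

end

theory Submission
  imports Defs "Jordan_Normal_Form.Determinant"
begin

text \<open>
  Fix \<open>k\<close>. The leading minor of order \<open>k\<close> of \<open>\<U>\<^sup>T A \<V>\<close> is a polynomial in
  the random diagonal entries. The zero set of a nonzero polynomial is a null set for every product
  of atomless distributions (\<open>AE_polynomial_nonzero\<close>, by Fubini's theorem one variable at a time),
  so it suffices to find one deterministic choice of the diagonal entries for which the minor does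
  not vanish; this choice may depend on \<open>k\<close> and may contain zeros.

  Since \<open>A\<close> is nonsingular, repeated Laplace expansion gives index sets \<open>I\<close>, \<open>J\<close> of size
  \<open>k\<close> with \<open>det A[I,J] \<noteq> 0\<close>. Suppose that \<open>\<U>\<close> maps the vectors supported on the
  first \<open>k\<close> coordinates onto the vectors supported on \<open>I\<close>, and \<open>\<V>\<close> maps them onto the
  vectors supported on \<open>J\<close>. Then the leading block \<open>C\<close> satisfies \<open>X\<^sup>T C Y = A[I,J]\<close>
  for suitable square matrices \<open>X\<close> and \<open>Y\<close>, whence \<open>det C \<noteq> 0\<close>
  (\<open>leading_minor_nonzero\<close>).

  It remains to route \<open>{0..<k}\<close> to an arbitrary \<open>I\<close> of size \<open>k\<close> by diagonal entries in
  \<open>{0, 1}\<close>. A butterfly with parameters \<open>(\<mu>, \<nu>)\<close> mixes the positions \<open>i\<close> and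
  \<open>i + h\<close> for \<open>i < \<mu>\<close>, where \<open>h = \<mu> + \<nu>\<close>. If one of the two is occupied, then
  zeroing one output sends its content to either of them; if both are occupied, then both stay
  occupied. So only the number of occupied positions in each pair matters. The routing is read from
  the last layer backwards, keeping the occupied positions of each block on a cyclic interval. Let
  the two children of a block contain \<open>k1\<close> and \<open>k2\<close> points of \<open>I\<close>. For the second child take
  the cyclic interval of length \<open>k2\<close> from \<open>c\<close>, and for the first child the one of length
  \<open>k1\<close> from \<open>c + k2\<close>. Modulo \<open>h\<close> these are together the consecutive integers
  \<open>c, ..., c + k1 + k2 - 1\<close>, and that is the reduction modulo \<open>h\<close> of the cyclic interval of
  length \<open>k1 + k2\<close> from \<open>c\<close> in the parent block. This works for every \<open>c\<close> if \<open>\<nu> = 0\<close>, and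
  for \<open>c = 0\<close> without any condition on \<open>\<nu>\<close> (\<open>cyclic_interval_split\<close>). The second case is
  all that is required of the last block of a layer, and the last block produces again a last block
  with start \<open>0\<close>. The root is a last block, so the routing starts from the cyclic interval
  \<open>{0..<k}\<close>; in the last layer all blocks have size \<open>1\<close> and the occupied set is \<open>I\<close>
  itself (\<open>rbt_carries\<close>).
\<close>

unbundle no vec_syntax
hide_const (open) Finite_Cartesian_Product.mat Finite_Cartesian_Product.vec Determinants.det

section \<open>Zeros of polynomials in independent atomless random variables\<close>

text \<open>
  Functions of a family of real variables, rather than a type of multivariate polynomials: this form
  composes directly with matrix entries. The set \<open>K\<close> holds the variables that may occur, so that
  such a function is well defined on the product space over \<open>K\<close>.
\<close>
inductive polynomial_in :: "'i set \<Rightarrow> (('i \<Rightarrow> real) \<Rightarrow> 'a::real_normed_field) \<Rightarrow> bool" for K where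
  const: "polynomial_in K (\<lambda>x. c)"
| coord: "i \<in> K \<Longrightarrow> polynomial_in K (\<lambda>x. of_real (x i))"
| add: "polynomial_in K f \<Longrightarrow> polynomial_in K g \<Longrightarrow> polynomial_in K (\<lambda>x. f x + g x)"
| mult: "polynomial_in K f \<Longrightarrow> polynomial_in K g \<Longrightarrow> polynomial_in K (\<lambda>x. f x * g x)"

lemma polynomial_in_sum:
  "(\<And>j. j \<in> J \<Longrightarrow> polynomial_in K (f j)) \<Longrightarrow> polynomial_in K (\<lambda>x. \<Sum>j\<in>J. f j x)"
  by (induction J rule: infinite_finite_induct) (auto intro: polynomial_in.intros)

lemma polynomial_in_prod:
  "(\<And>j. j \<in> J \<Longrightarrow> polynomial_in K (f j)) \<Longrightarrow> polynomial_in K (\<lambda>x. \<Prod>j\<in>J. f j x)"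
  by (induction J rule: infinite_finite_induct) (auto intro: polynomial_in.intros)

lemma polynomial_in_fix:
  assumes "polynomial_in (insert i K) f"
  shows "polynomial_in K (\<lambda>x. f (x(i := a)))"
  using assms
proof (induction rule: polynomial_in.induct)
  case (coord j)
  then show ?case
    by (cases "j = i") (auto intro: polynomial_in.intros)
qed (auto intro: polynomial_in.intros)

lemma polynomial_in_cong:
  assumes "polynomial_in K f" "\<And>i. i \<in> K \<Longrightarrow> x i = y i"
  shows "f x = f y"
  using assms by (induction rule: polynomial_in.induct) auto

lemma polynomial_in_line:
  assumes "polynomial_in K f"
  shows "\<exists>p. \<forall>t. f (x(i := t)) = poly p (of_real t)"
  using assms
proof (induction rule: polynomial_in.induct)
  case (const c)
  show ?case by (rule exI[of _ "[:c:]"]) simp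
next
  case (coord j)
  show ?case
    by (rule exI[of _ "if j = i then [:0, 1:] else [:of_real (x j):]"]) simp
next
  case (add f g)
  then obtain p q where "\<forall>t. f (x(i := t)) = poly p (of_real t)" "\<forall>t. g (x(i := t)) = poly q (of_real t)"
    by blast
  then show ?case by (intro exI[of _ "p + q"]) (simp del: fun_upd_apply)
next
  case (mult f g)
  then obtain p q where "\<forall>t. f (x(i := t)) = poly p (of_real t)" "\<forall>t. g (x(i := t)) = poly q (of_real t)"
    by blast
  then show ?case by (intro exI[of _ "p * q"]) (simp del: fun_upd_apply)
qed

lemma polynomial_in_measurable:
  fixes f :: "('i \<Rightarrow> real) \<Rightarrow> 'a::{real_normed_field, second_countable_topology}"
  assumes "polynomial_in K f" "\<And>i. sets (N i) = sets borel"
  shows "f \<in> borel_measurable (PiM K N)"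
  using assms(1)
proof (induction rule: polynomial_in.induct)
  case (coord i)
  have "(\<lambda>x. x i) \<in> measurable (PiM K N) (N i)"
    by (rule measurable_component_singleton) fact
  then have "(\<lambda>x. x i) \<in> borel_measurable (PiM K N)"
    using measurable_cong_sets[OF refl assms(2)] by blast
  then show ?case by (rule measurable_compose[OF _ borel_measurable_of_real])
qed auto

lemma AE_polynomial_line_nonzero:
  fixes f :: "('i \<Rightarrow> real) \<Rightarrow> 'a::real_normed_field"
  assumes "polynomial_in K f" "f (x(i := a)) \<noteq> 0"
    and "sets N = sets borel" "\<And>t. emeasure N {t} = 0"
  shows "AE t in N. f (x(i := t)) \<noteq> 0"
proof -
  obtain p where p: "\<And>t. f (x(i := t)) = poly p (of_real t)"
    using polynomial_in_line[OF assms(1)] by blast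
  have "p \<noteq> 0" using p[of a] assms(2) by auto
  then have "finite {z. poly p z = 0}" by (rule poly_roots_finite)
  then have "finite (of_real -` {z. poly p z = 0} :: real set)"
    by (rule finite_vimageI) (simp add: inj_of_real)
  then have fin: "finite {t. f (x(i := t)) = 0}" by (simp add: p vimage_def)
  have "{z} \<in> null_sets N" for z
    using assms(3,4) by (auto simp: null_sets_def)
  then have "AE t in N. t \<noteq> z" for z
    using AE_not_in[of "{z}" N] by simp
  then have "AE t in N. \<forall>z\<in>{t. f (x(i := t)) = 0}. t \<noteq> z"
    by (subst AE_finite_all[OF fin]) blast
  then show ?thesis by (rule AE_mp) (rule AE_I2, blast)
qed

text \<open>
  Induction on the variables. Freezing the new variable \<open>i\<close> at \<open>a i\<close> leaves a polynomial that
  is still nonzero at \<open>a\<close>, hence nonzero for almost all values of the others. For each of these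
  values the restriction to the line in direction \<open>i\<close> is a nonzero polynomial in one variable, with
  finitely many roots, which carry no mass. Fubini's theorem combines the two statements.
\<close>
lemma AE_PiM_polynomial_nonzero:
  fixes f :: "('i \<Rightarrow> real) \<Rightarrow> 'a::{real_normed_field, second_countable_topology}"
  assumes "finite K" "polynomial_in K f" "f a \<noteq> 0"
    and prob: "\<And>i. prob_space (N i)" and sets: "\<And>i. sets (N i) = sets borel"
    and atomless: "\<And>i t. i \<in> K \<Longrightarrow> emeasure (N i) {t} = 0"
  shows "AE x in PiM K N. f x \<noteq> 0"
  using assms(1-3,6)
proof (induction K arbitrary: f rule: finite_induct)
  case empty
  have "f x \<noteq> 0" for x
    using polynomial_in_cong[OF empty.prems(1), of x a] empty.prems(2) by simp
  then show ?case by simp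
next
  case (insert i K)
  interpret product_prob_space N "insert i K"
    using prob by (rule product_prob_spaceI)
  have f[measurable]: "f \<in> borel_measurable (PiM (insert i K) N)"
    by (rule polynomial_in_measurable[OF insert.prems(1) sets])
  define h where "h = (\<lambda>x. indicator {x. f x = 0} x :: ennreal)"
  have h: "h \<in> borel_measurable (PiM (insert i K) N)"
    unfolding h_def indicator_def by measurable
  have "AE x in PiM K N. f (x(i := a i)) \<noteq> 0"
    using insert.IH[of "\<lambda>x. f (x(i := a i))", OF polynomial_in_fix[OF insert.prems(1)]] insert.prems(2,3)
    by (simp del: fun_upd_apply)
  then have "AE x in PiM K N. (\<integral>\<^sup>+ y. h (x(i := y)) \<partial>(N i)) = 0"
  proof (rule AE_mp, intro AE_I2 impI)
    fix x assume "f (x(i := a i)) \<noteq> 0"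
    then have "AE t in N i. f (x(i := t)) \<noteq> 0"
      by (rule AE_polynomial_line_nonzero[OF insert.prems(1) _ sets insert.prems(3)]) simp_all
    then have "AE t in N i. h (x(i := t)) = 0" by (rule AE_mp) (simp add: h_def)
    then have "(\<integral>\<^sup>+ y. h (x(i := y)) \<partial>(N i)) = (\<integral>\<^sup>+ y. 0 \<partial>(N i))" by (rule nn_integral_cong_AE)
    then show "(\<integral>\<^sup>+ y. h (x(i := y)) \<partial>(N i)) = 0" by simp
  qed
  then have "(\<integral>\<^sup>+ x. (\<integral>\<^sup>+ y. h (x(i := y)) \<partial>(N i)) \<partial>(PiM K N)) = (\<integral>\<^sup>+ x. 0 \<partial>(PiM K N))"
    by (rule nn_integral_cong_AE)
  then have "(\<integral>\<^sup>+ x. h x \<partial>(PiM (insert i K) N)) = 0"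
    using product_nn_integral_insert[OF insert.hyps h] by simp
  then have "AE x in PiM (insert i K) N. h x = 0"
    using nn_integral_0_iff_AE[OF h] by simp
  then show ?case by (rule AE_mp) (auto simp: h_def indicator_def)
qed

text \<open>
  Independence says that the joint distribution is the product of the marginals.
\<close>
lemma (in prob_space) AE_polynomial_nonzero:
  fixes f :: "('i \<Rightarrow> real) \<Rightarrow> 'b::{real_normed_field, second_countable_topology}"
  assumes "finite K" and indep: "indep_vars (\<lambda>_. borel) X K"
    and atomless: "\<And>i t. i \<in> K \<Longrightarrow> measure M {\<omega> \<in> space M. X i \<omega> = t} = 0"
    and f: "polynomial_in K f" "f a \<noteq> 0"
  shows "AE \<omega> in M. f (\<lambda>i. X i \<omega>) \<noteq> 0"
proof (cases "K = {}")
  case True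
  then have "f x \<noteq> 0" for x
    using polynomial_in_cong[OF f(1), of x a] f(2) by simp
  then show ?thesis by simp
next
  case False
  have X[measurable]: "random_variable borel (X i)" if "i \<in> K" for i
    using indep that by (auto simp: indep_vars_def)
  \<comment> \<open>The product needs a probability measure at every index, also outside \<open>K\<close>.\<close>
  define N where "N = (\<lambda>i. if i \<in> K then distr M borel (X i) else return borel 0)"
  have prob: "prob_space (N i)" for i
    by (simp add: N_def prob_space_distr X prob_space_return)
  have sets: "sets (N i) = sets borel" for i by (simp add: N_def)
  have null: "emeasure (N i) {t} = 0" if "i \<in> K" for i t
    using atomless[OF that, of t] that
    by (simp add: N_def emeasure_distr X vimage_def Int_def conj_commute emeasure_eq_measure)
  have "PiM K N = (\<Pi>\<^sub>M i\<in>K. distr M borel (X i))"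
    by (rule PiM_cong) (simp_all add: N_def)
  also have "\<dots> = distr M (\<Pi>\<^sub>M i\<in>K. borel) (\<lambda>\<omega>. \<lambda>i\<in>K. X i \<omega>)"
    using indep_vars_iff_distr_eq_PiM'[where M' = "\<lambda>_. borel", OF False X] indep by simp
  finally have joint: "PiM K N = distr M (\<Pi>\<^sub>M i\<in>K. borel) (\<lambda>\<omega>. \<lambda>i\<in>K. X i \<omega>)" .
  have "AE x in PiM K N. f x \<noteq> 0"
    by (rule AE_PiM_polynomial_nonzero[where f = f and a = a, OF assms(1) f prob sets null])
  then have "AE x in distr M (\<Pi>\<^sub>M i\<in>K. borel) (\<lambda>\<omega>. \<lambda>i\<in>K. X i \<omega>). f x \<noteq> 0"
    unfolding joint .
  then have "AE \<omega> in M. f (\<lambda>i\<in>K. X i \<omega>) \<noteq> 0"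
    by (rule AE_distrD[rotated]) (simp add: X measurable_restrict)
  moreover have "f (\<lambda>i\<in>K. X i \<omega>) = f (\<lambda>i. X i \<omega>)" for \<omega>
    by (rule polynomial_in_cong[OF f(1)]) simp
  ultimately show ?thesis by simp
qed

section \<open>Minors and supports\<close>

lemma invertible_mat_iff_det:
  fixes A :: "'a::field mat"
  assumes A: "A \<in> carrier_mat n n"
  shows "invertible_mat A \<longleftrightarrow> det A \<noteq> 0"
proof
  assume "invertible_mat A"
  then obtain B where AB: "A * B = 1\<^sub>m n" "B * A = 1\<^sub>m (dim_row B)"
    using A by (auto simp: invertible_mat_def inverts_mat_def)
  then have "B \<in> carrier_mat n n"
    by (metis A carrier_matD(2) carrier_matI index_mult_mat(2,3) index_one_mat(2,3))
  then show "det A \<noteq> 0"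
    using det_mult[OF A, of B] AB(1) by auto
next
  assume "det A \<noteq> 0"
  from det_non_zero_imp_unit[OF A this, of "()"] obtain B
    where "B \<in> carrier_mat n n" "A * B = 1\<^sub>m n" "B * A = 1\<^sub>m n"
    by (auto simp: Units_def ring_mat_def)
  then show "invertible_mat A"
    using A by (auto simp: invertible_mat_def inverts_mat_def)
qed

lemma submatrix_leading:
  assumes A: "A \<in> carrier_mat n n" and k: "k \<le> n"
  shows "submatrix A {..<k} {..<k} = Matrix.mat k k (\<lambda>(i, j). A $$ (i, j))"
proof -
  have card: "card {i. i < n \<and> i \<in> {..<k}} = k"
  proof -
    have "{i. i < n \<and> i \<in> {..<k}} = {..<k}" using k by auto
    then show ?thesis by simp
  qed
  have pick: "pick {..<k} i = i" if "i < k" for i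
  proof -
    have "{a \<in> {..<k}. a < i} = {..<i}" using that by auto
    then show ?thesis using pick_card_in_set[of i "{..<k}"] that by simp
  qed
  show ?thesis
    unfolding submatrix_def using A card pick by (intro eq_matI) auto
qed

text \<open>
  Multiplication by these 0/1 matrices extracts columns; it turns the extraction of minors into matrix
  products, to which multiplicativity of the determinant applies.
\<close>
definition selection_mat :: "nat \<Rightarrow> nat \<Rightarrow> (nat \<Rightarrow> nat) \<Rightarrow> 'a::semiring_1 mat" where
  "selection_mat n k f = Matrix.mat n k (\<lambda>(a, j). if a = f j then 1 else 0)"

lemma selection_mat_carrier [simp]: "selection_mat n k f \<in> carrier_mat n k"
  by (simp add: selection_mat_def)

lemma minor_eq_selection:
  fixes A :: "'a::comm_ring_1 mat"
  assumes A: "A \<in> carrier_mat n n" and f: "f ` {..<k} \<subseteq> {..<n}" and g: "g ` {..<k} \<subseteq> {..<n}"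
  shows "(selection_mat n k f)\<^sup>T * A * selection_mat n k g = Matrix.mat k k (\<lambda>(i, j). A $$ (f i, g j))"
    (is "?L = ?R")
proof (rule eq_matI)
  fix i j assume "i < dim_row ?R" "j < dim_col ?R"
  then have ij: "i < k" "j < k" by auto
  have fg: "f i < n" "g j < n" using f g ij by auto
  have row: "((selection_mat n k f)\<^sup>T * A) $$ (i, b) = A $$ (f i, b)" if "b < n" for b
  proof -
    have "((selection_mat n k f)\<^sup>T * A) $$ (i, b) = (\<Sum>a\<in>{0..<n}. (if a = f i then 1 else 0) * A $$ (a, b))"
      using A ij that by (simp add: selection_mat_def scalar_prod_def)
    also have "\<dots> = (\<Sum>a\<in>{0..<n}. if a = f i then A $$ (f i, b) else 0)"
      by (intro sum.cong) auto
    finally show ?thesis using fg by simp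
  qed
  have "?L $$ (i, j) = (\<Sum>b\<in>{0..<n}. ((selection_mat n k f)\<^sup>T * A) $$ (i, b) * (if b = g j then 1 else 0))"
    using A ij by (simp add: selection_mat_def scalar_prod_def)
  also have "\<dots> = (\<Sum>b\<in>{0..<n}. if b = g j then A $$ (f i, g j) else 0)"
    using row by (intro sum.cong) auto
  finally show "?L $$ (i, j) = ?R $$ (i, j)" using fg ij by simp
qed (simp_all add: selection_mat_def)

text \<open>
  Descending induction on \<open>k\<close>: some cofactor in the Laplace expansion of a nonzero minor of order
  \<open>k + 1\<close> along its first column is nonzero.
\<close>
lemma exists_nonzero_minor:
  fixes A :: "'a::comm_ring_1 mat"
  assumes A: "A \<in> carrier_mat n n" and det: "det A \<noteq> 0" and "k \<le> n"
  shows "\<exists>f g. inj_on f {..<k} \<and> f ` {..<k} \<subseteq> {..<n} \<and> inj_on g {..<k} \<and> g ` {..<k} \<subseteq> {..<n} \<and>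
    det (Matrix.mat k k (\<lambda>(i, j). A $$ (f i, g j))) \<noteq> 0"
  using \<open>k \<le> n\<close>
proof (induction rule: inc_induct)
  case base
  have "Matrix.mat n n (\<lambda>(i, j). A $$ (i, j)) = A" using A by (intro eq_matI) auto
  with det show ?case by (intro exI[of _ id]) auto
next
  case (step k)
  then obtain f g where f: "inj_on f {..<Suc k}" "f ` {..<Suc k} \<subseteq> {..<n}"
    and g: "inj_on g {..<Suc k}" "g ` {..<Suc k} \<subseteq> {..<n}"
    and B: "det (Matrix.mat (Suc k) (Suc k) (\<lambda>(i, j). A $$ (f i, g j))) \<noteq> 0"
    by blast
  let ?B = "Matrix.mat (Suc k) (Suc k) (\<lambda>(i, j). A $$ (f i, g j))"
  have "(\<Sum>i<Suc k. ?B $$ (i, 0) * cofactor ?B i 0) \<noteq> 0"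
    using laplace_expansion_column[of ?B "Suc k" 0] B by simp
  then obtain i where i: "i < Suc k" "?B $$ (i, 0) * cofactor ?B i 0 \<noteq> 0"
    by (meson lessThan_iff sum.not_neutral_contains_not_neutral)
  then have minor: "det (mat_delete ?B i 0) \<noteq> 0"
    by (auto simp: cofactor_def)
  have "mat_delete ?B i 0 = Matrix.mat k k (\<lambda>(a, b). A $$ ((f \<circ> insert_index i) a, (g \<circ> Suc) b))"
    using i by (intro eq_matI) (auto simp: mat_delete_def insert_index_def)
  moreover have "inj_on (f \<circ> insert_index i) {..<k}"
    using f(1) by (intro comp_inj_on) (auto simp: inj_on_def insert_index_def split: if_splits)
  moreover have "inj_on (g \<circ> Suc) {..<k}"
    using g(1) by (intro comp_inj_on) (auto simp: inj_on_def)
  moreover have "(f \<circ> insert_index i) ` {..<k} \<subseteq> {..<n}" "(g \<circ> Suc) ` {..<k} \<subseteq> {..<n}"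
    using f(2) g(2) by (auto simp: insert_index_def image_subset_iff)
  ultimately show ?case using minor by metis
qed

definition supported :: "nat \<Rightarrow> nat set \<Rightarrow> 'a::zero vec set" where
  "supported n S = {v \<in> carrier_vec n. \<forall>i<n. i \<notin> S \<longrightarrow> v $ i = 0}"

text \<open>
  Surjectivity from the vectors supported on \<open>S\<close> to those supported on \<open>T\<close>. The image of the
  former may be larger; this suffices for minors and is stable under composition.
\<close>
definition carries :: "nat \<Rightarrow> 'a::semiring_0 mat \<Rightarrow> nat set \<Rightarrow> nat set \<Rightarrow> bool" where
  "carries n P S T \<longleftrightarrow> (\<forall>w\<in>supported n T. \<exists>v\<in>supported n S. P *\<^sub>v v = w)"

text \<open>
  The columns of \<open>X\<close> are preimages of the unit vectors at the positions \<open>f 0, ..., f (k - 1)\<close>,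
  cut off to the first \<open>k\<close> coordinates.
\<close>
lemma carries_selection:
  fixes U :: "'a::comm_ring_1 mat"
  assumes U: "U \<in> carrier_mat n n" and carries: "carries n U {..<k} (f ` {..<k})"
  shows "\<exists>X\<in>carrier_mat k k. U * selection_mat n k id * X = selection_mat n k f"
proof -
  have "\<exists>x\<in>supported n {..<k}. U *\<^sub>v x = vec n (\<lambda>a. if a = f j then 1 else 0)" if "j < k" for j
  proof -
    have "vec n (\<lambda>a. if a = f j then 1 else 0) \<in> supported n (f ` {..<k})"
      using that by (auto simp: supported_def)
    with carries show ?thesis unfolding carries_def by blast
  qed
  then obtain x where x: "\<And>j. j < k \<Longrightarrow> x j \<in> supported n {..<k}"
    and Ux: "\<And>j. j < k \<Longrightarrow> U *\<^sub>v x j = vec n (\<lambda>a. if a = f j then 1 else 0)"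
    by metis
  define X where "X = Matrix.mat k k (\<lambda>(a, j). x j $ a)"
  define Y where "Y = Matrix.mat n k (\<lambda>(a, j). x j $ a)"
  have X: "X \<in> carrier_mat k k" by (simp add: X_def)
  have "selection_mat n k id * X = Y"
  proof (rule eq_matI)
    fix a j assume "a < dim_row Y" "j < dim_col Y"
    then have aj: "a < n" "j < k" by (auto simp: Y_def)
    then have "(selection_mat n k id * X) $$ (a, j) = (\<Sum>b\<in>{0..<k}. (if a = b then 1 else 0) * x j $ b)"
      by (simp add: selection_mat_def X_def scalar_prod_def)
    also have "\<dots> = (\<Sum>b\<in>{0..<k}. if a = b then x j $ a else 0)"
      by (intro sum.cong) auto
    also have "\<dots> = x j $ a"
      using x[OF aj(2)] aj(1) by (auto simp: supported_def)
    finally show "(selection_mat n k id * X) $$ (a, j) = Y $$ (a, j)"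
      using aj by (simp add: Y_def)
  qed (simp_all add: selection_mat_def X_def Y_def)
  moreover have "U * Y = selection_mat n k f"
  proof (rule eq_matI)
    fix i j assume "i < dim_row (selection_mat n k f)" "j < dim_col (selection_mat n k f)"
    then have ij: "i < n" "j < k" by (auto simp: selection_mat_def)
    have "col Y j = x j"
      using x[OF ij(2)] ij by (intro eq_vecI) (auto simp: Y_def supported_def)
    then have "(U * Y) $$ (i, j) = (U *\<^sub>v x j) $ i"
      using U ij by (simp add: Y_def)
    then show "(U * Y) $$ (i, j) = selection_mat n k f $$ (i, j)"
      using Ux[OF ij(2)] ij by (simp add: selection_mat_def)
  qed (use U in \<open>simp_all add: selection_mat_def Y_def\<close>)
  ultimately have "U * selection_mat n k id * X = selection_mat n k f"
    using assoc_mult_mat[OF U selection_mat_carrier X] by simp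
  with X show ?thesis by blast
qed

text \<open>
  With \<open>U E X\<close> and \<open>V E Y\<close> the selections by \<open>f\<close> and \<open>g\<close>, where \<open>E\<close> selects the
  first \<open>k\<close> coordinates, the leading block \<open>C = E\<^sup>T U\<^sup>T A V E\<close> satisfies
  \<open>X\<^sup>T C Y = (U E X)\<^sup>T A (V E Y)\<close>, which is the given nonsingular submatrix of \<open>A\<close>.
\<close>
lemma leading_minor_nonzero:
  fixes A :: "'a::idom mat"
  assumes A: "A \<in> carrier_mat n n" and U: "U \<in> carrier_mat n n" and V: "V \<in> carrier_mat n n"
    and k: "k \<le> n" and f: "f ` {..<k} \<subseteq> {..<n}" and g: "g ` {..<k} \<subseteq> {..<n}"
    and minor: "det (Matrix.mat k k (\<lambda>(i, j). A $$ (f i, g j))) \<noteq> 0"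
    and fU: "carries n U {..<k} (f ` {..<k})" and gV: "carries n V {..<k} (g ` {..<k})"
  shows "det (Matrix.mat k k (\<lambda>(i, j). (U\<^sup>T * A * V) $$ (i, j))) \<noteq> 0"
proof -
  let ?E = "selection_mat n k id :: 'a mat"
  have E: "?E \<in> carrier_mat n k" by simp
  obtain X where X: "X \<in> carrier_mat k k" and UX: "U * ?E * X = selection_mat n k f"
    using carries_selection[OF U fU] by blast
  obtain Y where Y: "Y \<in> carrier_mat k k" and VY: "V * ?E * Y = selection_mat n k g"
    using carries_selection[OF V gV] by blast
  have W: "U\<^sup>T * A * V \<in> carrier_mat n n" using U A V by simp
  define C where "C = Matrix.mat k k (\<lambda>(i, j). (U\<^sup>T * A * V) $$ (i, j))"
  have C: "C \<in> carrier_mat k k" by (simp add: C_def)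
  have C_eq: "C = ?E\<^sup>T * (U\<^sup>T * A * V) * ?E"
    using minor_eq_selection[OF W, of id k id] k by (simp add: C_def)
  have "Matrix.mat k k (\<lambda>(i, j). A $$ (f i, g j)) = (U * ?E * X)\<^sup>T * A * (V * ?E * Y)"
    using minor_eq_selection[OF A f g] UX VY by simp
  also have "\<dots> = X\<^sup>T * (?E\<^sup>T * U\<^sup>T) * A * (V * ?E * Y)"
    using transpose_mult[OF U E] transpose_mult[OF mult_carrier_mat[OF U E] X] by simp
  also have "\<dots> = X\<^sup>T * C * Y"
  proof -
    have assoc: "P * Q * R = P * (Q * R)"
      if "dim_col P = dim_row Q" "dim_col Q = dim_row R" for P Q R :: "'a mat"
      using that by (intro assoc_mult_mat) auto
    show ?thesis unfolding C_eq
      using carrier_matD[OF X] carrier_matD[OF U] carrier_matD[OF A] carrier_matD[OF V]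
        carrier_matD[OF Y] carrier_matD[OF E]
      by (simp add: assoc)
  qed
  finally have "det (X\<^sup>T * C * Y) \<noteq> 0" using minor by simp
  moreover have "det (X\<^sup>T * C * Y) = det (X\<^sup>T) * det C * det Y"
    using X C Y by (simp add: det_mult[of _ k] mult_carrier_mat[of _ k k])
  ultimately show ?thesis by (auto simp: C_def)
qed

section \<open>Solving one butterfly on prescribed supports\<close>

lemma butterfly_carrier [simp]: "butterfly (\<mu>, \<nu>) \<in> carrier_mat (2 * \<mu> + \<nu>) (2 * \<mu> + \<nu>)"
  by (simp add: butterfly_def)

lemma butterfly_mult_vec:
  fixes v :: "'a::real_field vec"
  assumes v: "v \<in> carrier_vec (2 * \<mu> + \<nu>)"
  shows "i < \<mu> \<Longrightarrow> (butterfly (\<mu>, \<nu>) *\<^sub>v v) $ i = of_real (1 / sqrt 2) * (v $ i + v $ (i + (\<mu> + \<nu>)))"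
    and "i < \<mu> \<Longrightarrow> (butterfly (\<mu>, \<nu>) *\<^sub>v v) $ (i + (\<mu> + \<nu>)) = of_real (1 / sqrt 2) * (v $ i - v $ (i + (\<mu> + \<nu>)))"
    and "\<mu> \<le> i \<Longrightarrow> i < \<mu> + \<nu> \<Longrightarrow> (butterfly (\<mu>, \<nu>) *\<^sub>v v) $ i = v $ i"
proof -
  let ?m = "2 * \<mu> + \<nu>" and ?h = "\<mu> + \<nu>" and ?c = "of_real (1 / sqrt 2) :: 'a"
  have entry: "(butterfly (\<mu>, \<nu>) *\<^sub>v v) $ a = (\<Sum>j\<in>{0..<?m}. butterfly (\<mu>, \<nu>) $$ (a, j) * v $ j)"
    if "a < ?m" for a
    using that v by (simp add: scalar_prod_def butterfly_def)
  {
    assume i: "i < \<mu>"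
    then have "i < ?m" by simp
    have "(butterfly (\<mu>, \<nu>) *\<^sub>v v) $ i = (\<Sum>j\<in>{i, i + ?h}. butterfly (\<mu>, \<nu>) $$ (i, j) * v $ j)"
      unfolding entry[OF \<open>i < ?m\<close>]
      using i by (intro sum.mono_neutral_right) (auto simp: butterfly_def)
    also have "\<dots> = ?c * (v $ i + v $ (i + ?h))"
      using i by (simp add: butterfly_def distrib_left)
    finally show "(butterfly (\<mu>, \<nu>) *\<^sub>v v) $ i = ?c * (v $ i + v $ (i + ?h))" .
    have "i + ?h < ?m" using i by simp
    then have "(butterfly (\<mu>, \<nu>) *\<^sub>v v) $ (i + ?h) = (\<Sum>j\<in>{i, i + ?h}. butterfly (\<mu>, \<nu>) $$ (i + ?h, j) * v $ j)"
      unfolding entry[OF \<open>i + ?h < ?m\<close>]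
      using i by (intro sum.mono_neutral_right) (auto simp: butterfly_def)
    also have "\<dots> = ?c * (v $ i - v $ (i + ?h))"
      using i by (simp add: butterfly_def right_diff_distrib)
    finally show "(butterfly (\<mu>, \<nu>) *\<^sub>v v) $ (i + ?h) = ?c * (v $ i - v $ (i + ?h))" .
  }
  assume i: "\<mu> \<le> i" "i < \<mu> + \<nu>"
  then have "i < ?m" by simp
  then have "(butterfly (\<mu>, \<nu>) *\<^sub>v v) $ i = (\<Sum>j\<in>{i}. butterfly (\<mu>, \<nu>) $$ (i, j) * v $ j)"
    unfolding entry[OF \<open>i < ?m\<close>]
    using i by (intro sum.mono_neutral_right) (auto simp: butterfly_def)
  then show "(butterfly (\<mu>, \<nu>) *\<^sub>v v) $ i = v $ i"
    using i by (simp add: butterfly_def)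
qed

text \<open>
  One pair of a butterfly: \<open>iS\<close>, \<open>jS\<close> say which inputs may be nonzero and \<open>iT\<close>, \<open>jT\<close>
  which outputs are prescribed. Two prescribed outputs require both inputs (the 2 by 2 block is its own
  inverse); one prescribed output can be produced from either input, since no entry of the block is
  zero.
\<close>
lemma butterfly_pair_solve:
  fixes a b :: "'a::real_field"
  assumes "iT \<or> jT \<Longrightarrow> iS \<or> jS" and "iT \<Longrightarrow> jT \<Longrightarrow> iS \<and> jS"
  shows "\<exists>p q. (\<not> iS \<longrightarrow> p = 0) \<and> (\<not> jS \<longrightarrow> q = 0) \<and>
    (iT \<longrightarrow> of_real (1 / sqrt 2) * (p + q) = a) \<and> (jT \<longrightarrow> of_real (1 / sqrt 2) * (p - q) = b)"
proof -
  let ?c = "of_real (1 / sqrt 2) :: 'a" and ?s = "of_real (sqrt 2) :: 'a"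
  have cs: "?c * ?s = 1" by (simp flip: of_real_mult)
  have "1 / sqrt 2 * (1 / sqrt 2 * 2) = (1::real)" by simp
  then have cc: "?c * (?c * 2) = 1"
    by (metis of_real_1 of_real_mult of_real_numeral)
  consider "iS" "jS" | "iS" "\<not> jS" | "\<not> iS" "jS" | "\<not> iS" "\<not> jS" by blast
  then show ?thesis
  proof cases
    case 1
    have "x * (x * (a + b) + x * (a - b)) = x * (x * 2) * a"
      "x * (x * (a + b) - x * (a - b)) = x * (x * 2) * b" for x :: 'a
      by (simp_all add: algebra_simps)
    from this[of ?c] show ?thesis using 1 cc
      by (intro exI[of _ "?c * (a + b)"] exI[of _ "?c * (a - b)"]) simp
  next
    case 2
    then show ?thesis using assms cs
      by (intro exI[of _ "?s * (if iT then a else b)"] exI[of _ 0]) (auto simp flip: mult.assoc)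
  next
    case 3
    then show ?thesis using assms cs
      by (intro exI[of _ 0] exI[of _ "?s * (if iT then a else - b)"]) (auto simp flip: mult.assoc)
  next
    case 4
    then show ?thesis using assms by blast
  qed
qed

text \<open>
  The pairs \<open>i\<close>, \<open>i + (\<mu> + \<nu>)\<close> and the fixed middle positions do not interact, so they are
  solved separately.
\<close>
lemma butterfly_solve:
  fixes w :: "'a::real_field vec"
  assumes single: "\<And>i. i < \<mu> \<Longrightarrow> i \<in> T \<or> i + (\<mu> + \<nu>) \<in> T \<Longrightarrow> i \<in> S \<or> i + (\<mu> + \<nu>) \<in> S"
    and both: "\<And>i. i < \<mu> \<Longrightarrow> i \<in> T \<Longrightarrow> i + (\<mu> + \<nu>) \<in> T \<Longrightarrow> i \<in> S \<and> i + (\<mu> + \<nu>) \<in> S"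
    and middle: "\<And>i. \<mu> \<le> i \<Longrightarrow> i < \<mu> + \<nu> \<Longrightarrow> i \<in> T \<Longrightarrow> i \<in> S"
  shows "\<exists>v\<in>supported (2 * \<mu> + \<nu>) S. \<forall>i<2 * \<mu> + \<nu>. i \<in> T \<longrightarrow> (butterfly (\<mu>, \<nu>) *\<^sub>v v) $ i = w $ i"
proof -
  let ?m = "2 * \<mu> + \<nu>" and ?h = "\<mu> + \<nu>" and ?c = "of_real (1 / sqrt 2) :: 'a"
  have "\<exists>p q. (i \<notin> S \<longrightarrow> p = 0) \<and> (i + ?h \<notin> S \<longrightarrow> q = 0) \<and>
    (i \<in> T \<longrightarrow> ?c * (p + q) = w $ i) \<and> (i + ?h \<in> T \<longrightarrow> ?c * (p - q) = w $ (i + ?h))" if "i < \<mu>" for i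
    by (rule butterfly_pair_solve) (use single both that in auto)
  then obtain p q where pq: "\<And>i. i < \<mu> \<Longrightarrow> (i \<notin> S \<longrightarrow> p i = 0) \<and> (i + ?h \<notin> S \<longrightarrow> q i = 0) \<and>
    (i \<in> T \<longrightarrow> ?c * (p i + q i) = w $ i) \<and> (i + ?h \<in> T \<longrightarrow> ?c * (p i - q i) = w $ (i + ?h))"
    by metis
  define v where "v = vec ?m (\<lambda>i. if i < \<mu> then p i else if i < ?h then (if i \<in> S then w $ i else 0) else q (i - ?h))"
  have v: "v \<in> carrier_vec ?m" by (simp add: v_def)
  have "v \<in> supported ?m S"
    using pq by (auto simp: supported_def v_def)
  moreover have "(butterfly (\<mu>, \<nu>) *\<^sub>v v) $ i = w $ i" if i: "i < ?m" "i \<in> T" for i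
  proof -
    consider "i < \<mu>" | "\<mu> \<le> i" "i < ?h" | j where "j < \<mu>" "i = j + ?h"
      using i(1) by (metis add.commute add_less_cancel_left le_Suc_ex mult_2 not_less group_cancel.add1)
    then show ?thesis
    proof cases
      case 1
      then show ?thesis using pq[OF 1] i(2) by (simp add: butterfly_mult_vec(1)[OF v 1]) (simp add: v_def)
    next
      case 2
      then show ?thesis using middle[OF 2] i(2) by (simp add: butterfly_mult_vec(3)[OF v 2]) (simp add: v_def)
    next
      case (3 j)
      then show ?thesis using pq[OF 3(1)] i(2) by (simp add: butterfly_mult_vec(2)[OF v 3(1)]) (simp add: v_def)
    qed
  qed
  ultimately show ?thesis by blast
qed


section \<open>Cyclic intervals and the two halves of a block\<close>

definition cyclic_interval :: "nat \<Rightarrow> nat \<Rightarrow> nat \<Rightarrow> nat set" where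
  "cyclic_interval m c k = (\<lambda>t. (c + t) mod m) ` {..<k}"

lemma cyclic_interval_from_0: "k \<le> m \<Longrightarrow> cyclic_interval m 0 k = {..<k}"
  by (auto simp: cyclic_interval_def image_iff)

lemma cyclic_interval_lt: "0 < m \<Longrightarrow> i \<in> cyclic_interval m c k \<Longrightarrow> i < m"
  by (auto simp: cyclic_interval_def)

lemma cyclic_interval_mod: "cyclic_interval m (c mod m) k = cyclic_interval m c k"
  by (simp add: cyclic_interval_def mod_simps)

lemma cyclic_interval_memI: "c \<le> u \<Longrightarrow> u < c + k \<Longrightarrow> u mod m \<in> cyclic_interval m c k"
  unfolding cyclic_interval_def by (intro image_eqI[of _ _ "u - c"]) auto

lemma cyclic_interval_memE:
  assumes "i \<in> cyclic_interval m c k"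
  obtains u where "c \<le> u" "u < c + k" "i = u mod m"
  using assms unfolding cyclic_interval_def by (metis (mono_tags, lifting) imageE le_add1 lessThan_iff nat_add_left_cancel_less)

lemma mod_double:
  fixes u h :: nat
  shows "u mod (2 * h) = u mod h \<or> u mod (2 * h) = u mod h + h"
proof (cases "h = 0")
  case False
  have "u mod (2 * h) mod h = u mod h" by (simp add: mod_mod_cancel)
  moreover have "u mod (2 * h) < 2 * h" using False by simp
  ultimately show ?thesis
    by (metis (no_types, lifting) False add.commute add_diff_cancel_left' le_add_diff_inverse le_mod_geq less_diff_conv2 mod_less mult_2 not_less)
qed simp

lemma mod_double_shift:
  fixes u h :: nat
  assumes "0 < h"
  shows "{u mod (2 * h), (u + h) mod (2 * h)} = {u mod h, u mod h + h}"
proof -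
  have "u mod (2 * h) \<noteq> (u + h) mod (2 * h)"
  proof
    assume "u mod (2 * h) = (u + h) mod (2 * h)"
    then have "2 * h dvd (u + h) - u" by (metis le_add1 mod_eq_dvd_iff_nat)
    then show False using assms by (auto dest: dvd_imp_le)
  qed
  moreover have "(u + h) mod h = u mod h" by simp
  ultimately show ?thesis using mod_double[of u h] mod_double[of "u + h" h] by auto
qed

lemma mod_eq_close:
  fixes u v h :: nat
  assumes "u mod h = v mod h" "u < v" "v < u + 2 * h"
  shows "v = u + h"
proof -
  have "h dvd v - u" using assms by (metis less_imp_le mod_eq_dvd_iff_nat)
  then obtain q where q: "v - u = h * q" by blast
  have "h * q < h * 2" "0 < h * q" using q assms(2,3) by linarith+
  then have "q = 1" by (auto simp: less_2_cases_iff)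
  then show ?thesis using q assms by simp
qed

text \<open>
  The set \<open>T\<close> is a union of two cyclic intervals in the two children of a block, and modulo \<open>h\<close>
  their elements are the consecutive integers \<open>c, ..., c + k1 + k2 - 1\<close>, first those of the second
  child. Therefore \<open>T\<close> meets a pair \<open>i\<close>, \<open>i + h\<close> in as many points as the parent interval
  \<open>S\<close> does. The conclusions are the premises of \<open>butterfly_solve\<close>. If \<open>\<nu> = 0\<close>, then the
  parent has size \<open>2 h\<close> and wrapping around is harmless; if \<open>c = 0\<close>, then \<open>S\<close> is an initial
  segment and does not wrap around.
\<close>
lemma cyclic_interval_split:
  fixes \<mu> \<nu> c k1 k2 :: nat
  defines "h \<equiv> \<mu> + \<nu>"
  defines "S \<equiv> cyclic_interval (\<mu> + h) c (k1 + k2)" and "T \<equiv> cyclic_interval h (c + k2) k1 \<union> (+) h ` cyclic_interval \<mu> c k2"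
  assumes \<nu>: "\<nu> = 0 \<or> c = 0" and k: "k1 \<le> h" "k2 \<le> \<mu>"
  shows "i < \<mu> \<Longrightarrow> i \<in> T \<or> i + h \<in> T \<Longrightarrow> i \<in> S \<or> i + h \<in> S"
    and "i < \<mu> \<Longrightarrow> i \<in> T \<Longrightarrow> i + h \<in> T \<Longrightarrow> i \<in> S \<and> i + h \<in> S"
    and "\<mu> \<le> i \<Longrightarrow> i < h \<Longrightarrow> i \<in> T \<Longrightarrow> i \<in> S"
proof -
  have low: "\<exists>u. c + k2 \<le> u \<and> u < c + (k1 + k2) \<and> i = u mod h" if "i \<in> T" "i < h" for i
    using that by (auto simp: T_def add.assoc add.left_commute elim!: cyclic_interval_memE)
  have high: "\<exists>u. c \<le> u \<and> u < c + k2 \<and> i = u mod \<mu>" if "i + h \<in> T" for i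
  proof -
    have "i + h \<notin> cyclic_interval h (c + k2) k1"
      using cyclic_interval_lt[of h "i + h" "c + k2" k1] k by (cases "h = 0") (auto simp: cyclic_interval_def)
    then have "i \<in> cyclic_interval \<mu> c k2"
      using that by (auto simp: T_def add.commute[of _ h])
    then show ?thesis by (rule cyclic_interval_memE) blast
  qed
  have S_cases: "S = {..<k1 + k2}" if "c = 0"
    using that k by (simp add: S_def cyclic_interval_from_0)
  have h\<mu>: "h = \<mu>" "\<mu> + h = 2 * h" if "\<nu> = 0" using that by (auto simp: h_def)
  have S_mem: "u mod (2 * h) \<in> S" if "\<nu> = 0" "c \<le> u" "u < c + (k1 + k2)" for u
    using cyclic_interval_memI[OF that(2,3), of "2 * h"] by (simp add: S_def h\<mu>(2)[OF that(1)])
  {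
    assume i: "i < \<mu>"
    then have "i < h" by (simp add: h_def)
    show "i \<in> S \<or> i + h \<in> S" if T: "i \<in> T \<or> i + h \<in> T"
    proof (cases "c = 0")
      case True
      have "\<exists>u<k1 + k2. i \<le> u"
        using T
      proof
        assume "i \<in> T"
        then obtain u where "u < k1 + k2" "i = u mod h" using low[OF _ \<open>i < h\<close>] True by auto
        then show ?thesis by (intro exI[of _ u]) simp
      next
        assume "i + h \<in> T"
        then obtain u where "u < k2" "i = u mod \<mu>" using high True by auto
        then show ?thesis by (intro exI[of _ u]) simp
      qed
      then show ?thesis using S_cases[OF True] by auto
    next
      case False
      then have "\<nu> = 0" using \<nu> by simp
      obtain u where u: "c \<le> u" "u < c + (k1 + k2)" "i = u mod h"
        using T
      proof
        assume "i \<in> T"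
        then obtain u where "c + k2 \<le> u" "u < c + (k1 + k2)" "i = u mod h" using low[OF _ \<open>i < h\<close>] by blast
        then show ?thesis using that[of u] by simp
      next
        assume "i + h \<in> T"
        then obtain u where "c \<le> u" "u < c + k2" "i = u mod \<mu>" using high by blast
        then show ?thesis using that[of u] h\<mu>[OF \<open>\<nu> = 0\<close>] by simp
      qed
      show ?thesis using S_mem[OF \<open>\<nu> = 0\<close> u(1,2)] mod_double[of u h] u(3) by auto
    qed
    show "i \<in> S \<and> i + h \<in> S" if T: "i \<in> T" "i + h \<in> T"
    proof -
      obtain u where u: "c + k2 \<le> u" "u < c + (k1 + k2)" "i = u mod h"
        using low[OF T(1) \<open>i < h\<close>] by blast
      obtain v where v: "c \<le> v" "v < c + k2" "i = v mod \<mu>" using high[OF T(2)] by blast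
      show ?thesis
      proof (cases "c = 0")
        case True
        \<comment> \<open>No reduction takes place in the second child, so \<open>u\<close> is a later integer in the same class.\<close>
        then have "v = i" using v k by simp
        then have "i < u" using u v True by simp
        then have "h \<le> u" using u(3) by (metis less_irrefl mod_less not_less)
        then have "i + h \<le> u" using u(3) by (metis add.commute le_diff_conv2 le_mod_geq mod_less_eq_dividend)
        then show ?thesis using u True S_cases by simp
      next
        case False
        then have "\<nu> = 0" using \<nu> by simp
        then have "v mod h = u mod h" using u v h\<mu> by simp
        then have "u = v + h" using u v k h\<mu>[OF \<open>\<nu> = 0\<close>] by (intro mod_eq_close) auto
        then have "{i, i + h} = {v mod (2 * h), u mod (2 * h)}"
          using mod_double_shift[of h v] \<open>i < h\<close> u(3) by simp
        moreover have "v mod (2 * h) \<in> S" "u mod (2 * h) \<in> S"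
          using S_mem[OF \<open>\<nu> = 0\<close>] u v by auto
        ultimately have "{i, i + h} \<subseteq> S" by simp
        then show ?thesis by simp
      qed
    qed
  }
  assume i: "\<mu> \<le> i" "i < h" "i \<in> T"
  then have "c = 0" using \<nu> by (auto simp: h_def)
  then show "i \<in> S" using low[OF i(3,2)] S_cases by (auto intro: le_less_trans[OF mod_less_eq_dividend])
qed

section \<open>Solving one layer\<close>

text \<open>
  A cell \<open>(m, c, I)\<close> records for a block of size \<open>m\<close> the set \<open>I\<close> of local positions to be
  reached at the end and the start \<open>c\<close> of the cyclic interval that is occupied on entry.
\<close>
type_synonym cell = "nat \<times> nat \<times> nat set"

text \<open>
  Both functions translate from positions within the blocks to positions in \<open>{0..<n}\<close>.
\<close>
fun targets :: "cell list \<Rightarrow> nat set" where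
  "targets [] = {}"
| "targets ((m, c, I) # cs) = I \<union> (+) m ` targets cs"

fun sources :: "cell list \<Rightarrow> nat set" where
  "sources [] = {}"
| "sources ((m, c, I) # cs) = cyclic_interval m c (card I) \<union> (+) m ` sources cs"

abbreviation cells_size :: "cell list \<Rightarrow> nat" where
  "cells_size cs \<equiv> sum_list (map fst cs)"

text \<open>
  The choice of the starts is the heart of the routing: the interval of the first child continues where
  that of the second child ends. The cells correspond to \<open>child_sizes\<close>, including the omission of
  empty blocks.
\<close>
definition children :: "nat \<times> nat \<Rightarrow> cell \<Rightarrow> cell list" where
  "children = (\<lambda>(\<mu>, \<nu>) (m, c, I). let h = \<mu> + \<nu>; I1 = I \<inter> {..<h}; I2 = {i. i + h \<in> I} in
     filter (\<lambda>cell. fst cell \<noteq> 0) [(h, (c + card I2) mod h, I1), (\<mu>, c mod \<mu>, I2)])"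

text \<open>
  The disjunction is the hypothesis of \<open>cyclic_interval_split\<close>.
\<close>
definition good_cell :: "nat \<times> nat \<Rightarrow> cell \<Rightarrow> bool" where
  "good_cell p cell \<longleftrightarrow> fst cell = butterfly_size p \<and> snd (snd cell) \<subseteq> {..<fst cell} \<and>
     (snd p = 0 \<or> fst (snd cell) = 0)"

lemma targets_append: "targets (cs @ ds) = targets cs \<union> (+) (cells_size cs) ` targets ds"
  by (induction cs rule: targets.induct) (auto simp: image_Un image_image add.assoc)

lemma sources_append: "sources (cs @ ds) = sources cs \<union> (+) (cells_size cs) ` sources ds"
  by (induction cs rule: sources.induct) (auto simp: image_Un image_image add.assoc)

lemma sizes_children:
  "fst cell = butterfly_size p \<Longrightarrow> map fst (children p cell) = child_sizes p"
  by (cases p; cases cell) (auto simp: children_def child_sizes_def Let_def)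

lemma children_nonzero: "d \<in> set (children p cell) \<Longrightarrow> fst d \<noteq> 0"
  by (cases p; cases cell) (auto simp: children_def Let_def split: if_splits)

lemma sources_lt:
  "(\<And>d. d \<in> set cs \<Longrightarrow> fst d \<noteq> 0) \<Longrightarrow> sources cs \<subseteq> {..<cells_size cs}"
proof (induction cs rule: sources.induct)
  case (2 m c I cs)
  then show ?case using cyclic_interval_lt[of m _ c "card I"] by fastforce
qed simp

lemma sum_child_sizes: "sum_list (child_sizes p) = butterfly_size p"
  by (cases p) (auto simp: child_sizes_def butterfly_size_def)

text \<open>
  The part of a target set in the first child, and the part in the second child shifted to local
  positions.
\<close>
lemma split_target:
  fixes \<mu> h :: nat
  assumes I: "I \<subseteq> {..<\<mu> + h}"
  shows "I = I \<inter> {..<h} \<union> (+) h ` {i. i + h \<in> I}"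
    and "card I = card (I \<inter> {..<h}) + card {i. i + h \<in> I}"
    and "card (I \<inter> {..<h}) \<le> h" and "card {i. i + h \<in> I} \<le> \<mu>"
    and "{i. i + h \<in> I} \<subseteq> {..<\<mu>}"
proof -
  show eq: "I = I \<inter> {..<h} \<union> (+) h ` {i. i + h \<in> I}"
  proof (intro equalityI subsetI)
    fix i assume "i \<in> I"
    then show "i \<in> I \<inter> {..<h} \<union> (+) h ` {i. i + h \<in> I}"
      by (cases "i < h") (auto simp: image_iff intro!: exI[of _ "i - h"])
  qed (auto simp: add.commute)
  show sub: "{i. i + h \<in> I} \<subseteq> {..<\<mu>}" using I by auto
  then have "finite {i. i + h \<in> I}" by (rule finite_subset) simp
  then have "card (I \<inter> {..<h} \<union> (+) h ` {i. i + h \<in> I}) =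
      card (I \<inter> {..<h}) + card ((+) h ` {i. i + h \<in> I})"
    by (intro card_Un_disjoint) auto
  then show "card I = card (I \<inter> {..<h}) + card {i. i + h \<in> I}"
    using eq by (simp add: card_image)
  show "card (I \<inter> {..<h}) \<le> h" by (metis Int_lower2 card_lessThan card_mono finite_lessThan)
  show "card {i. i + h \<in> I} \<le> \<mu>" using card_mono[OF _ sub] by simp
qed

lemma targets_children:
  assumes "good_cell p cell"
  shows "targets (children p cell) = snd (snd cell)"
proof -
  obtain \<mu> \<nu> m c I where p: "p = (\<mu>, \<nu>)" and cell: "cell = (m, c, I)" by (metis prod.exhaust)
  have I: "I \<subseteq> {..<\<mu> + (\<mu> + \<nu>)}"
    using assms by (auto simp: good_cell_def p cell butterfly_size_def)
  show ?thesis
    using split_target(1,5)[OF I] by (auto simp: children_def p cell Let_def)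
qed

lemma sources_children:
  assumes "good_cell (\<mu>, \<nu>) (m, c, I)"
  shows "sources (children (\<mu>, \<nu>) (m, c, I)) =
    cyclic_interval (\<mu> + \<nu>) (c + card {i. i + (\<mu> + \<nu>) \<in> I}) (card (I \<inter> {..<\<mu> + \<nu>}))
      \<union> (+) (\<mu> + \<nu>) ` cyclic_interval \<mu> c (card {i. i + (\<mu> + \<nu>) \<in> I})"
proof -
  have I: "I \<subseteq> {..<\<mu> + (\<mu> + \<nu>)}"
    using assms by (auto simp: good_cell_def butterfly_size_def)
  show ?thesis
    using split_target(3,4)[OF I] by (auto simp: children_def Let_def cyclic_interval_def[of _ _ 0] cyclic_interval_mod)
qed

lemma cell_solve:
  fixes w :: "'a::real_field vec"
  assumes good: "good_cell p cell"
  shows "\<exists>v\<in>supported (fst cell) (sources [cell]). \<forall>i<fst cell.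
    i \<in> sources (children p cell) \<longrightarrow> (butterfly p *\<^sub>v v) $ i = w $ i"
proof -
  obtain \<mu> \<nu> m c I where p: "p = (\<mu>, \<nu>)" and cell: "cell = (m, c, I)" by (metis prod.exhaust)
  have m: "m = 2 * \<mu> + \<nu>" "\<mu> + (\<mu> + \<nu>) = 2 * \<mu> + \<nu>" and c: "\<nu> = 0 \<or> c = 0"
    and I: "I \<subseteq> {..<\<mu> + (\<mu> + \<nu>)}"
    using good by (auto simp: good_cell_def p cell butterfly_size_def)
  note sp = split_target[OF I]
  have "\<exists>v\<in>supported (2 * \<mu> + \<nu>) (cyclic_interval (2 * \<mu> + \<nu>) c (card I)).
    \<forall>i<2 * \<mu> + \<nu>. i \<in> sources (children p cell) \<longrightarrow> (butterfly (\<mu>, \<nu>) *\<^sub>v v) $ i = w $ i"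
    unfolding p cell sources_children[OF good[unfolded p cell]]
    using cyclic_interval_split[OF c sp(3,4)] unfolding m(2) sp(2)[symmetric]
    by (intro butterfly_solve) auto
  then show ?thesis by (simp add: p cell m)
qed

lemma diag_block_butterfly_carrier:
  "diag_block_mat (map butterfly L) \<in> carrier_mat (sum_list (map butterfly_size L)) (sum_list (map butterfly_size L))"
proof -
  have "dim_row (butterfly p :: 'a mat) = butterfly_size p" "dim_col (butterfly p :: 'a mat) = butterfly_size p" for p
    by (cases p; simp add: butterfly_def butterfly_size_def)+
  then show ?thesis by (intro carrier_matI) (simp_all add: dim_diag_block_mat o_def)
qed

text \<open>
  Block-diagonality reduces a layer to its blocks. The output is only prescribed on the positions that
  the next layer needs; the following diagonal matrix erases the rest.
\<close>
lemma layer_solve: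
  fixes w :: "'a::real_field vec"
  assumes "list_all2 good_cell L cs"
  shows "\<exists>v\<in>supported (cells_size cs) (sources cs). \<forall>i<cells_size cs.
    i \<in> sources (concat (map2 children L cs)) \<longrightarrow> (diag_block_mat (map butterfly L) *\<^sub>v v) $ i = w $ i"
  using assms
proof (induction arbitrary: w rule: list_all2_induct)
  case Nil
  show ?case by (intro bexI[of _ "0\<^sub>v 0"]) (simp_all add: supported_def)
next
  case (Cons p L cell cs)
  obtain m c I where cell: "cell = (m, c, I)" by (metis prod.exhaust)
  let ?k = "cells_size cs" and ?D = "diag_block_mat (map butterfly L) :: 'a mat"
  have m: "m = butterfly_size p" using Cons.hyps(1) by (simp add: good_cell_def cell)
  have k: "?k = sum_list (map butterfly_size L)"
    using Cons.hyps(2) by (induction rule: list_all2_induct) (auto simp: good_cell_def)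
  have B: "(butterfly p :: 'a mat) \<in> carrier_mat m m"
    by (cases p) (simp add: m butterfly_size_def)
  have D: "?D \<in> carrier_mat ?k ?k" unfolding k by (rule diag_block_butterfly_carrier)
  have size_ch: "cells_size (children p cell) = m"
    using Cons.hyps(1) by (simp add: sizes_children good_cell_def sum_child_sizes m)
  obtain v1 where v1: "v1 \<in> supported m (sources [cell])"
    and w1: "\<And>i. i < m \<Longrightarrow> i \<in> sources (children p cell) \<Longrightarrow> (butterfly p *\<^sub>v v1) $ i = w $ i"
    using cell_solve[OF Cons.hyps(1), of w] by (auto simp: cell)
  obtain v2 where v2: "v2 \<in> supported ?k (sources cs)"
    and w2: "\<And>i. i < ?k \<Longrightarrow> i \<in> sources (concat (map2 children L cs)) \<Longrightarrow> (?D *\<^sub>v v2) $ i = w $ (m + i)"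
    using Cons.IH[of "vec ?k (\<lambda>i. w $ (m + i))"] by auto
  have car: "v1 \<in> carrier_vec m" "v2 \<in> carrier_vec ?k" using v1 v2 by (auto simp: supported_def)
  have mult: "diag_block_mat (map butterfly (p # L)) *\<^sub>v (v1 @\<^sub>v v2) = (butterfly p *\<^sub>v v1) @\<^sub>v (?D *\<^sub>v v2)"
    using mult_mat_vec_split[OF B D car] carrier_matD[OF B] carrier_matD[OF D] by (simp add: Let_def)
  have children_lt: "i < m" if "i \<in> sources (children p cell)" for i
    using that sources_lt[of "children p cell"] children_nonzero[of _ p cell] size_ch by auto
  show ?case
  proof (rule bexI[of _ "v1 @\<^sub>v v2"])
    show "v1 @\<^sub>v v2 \<in> supported (cells_size (cell # cs)) (sources (cell # cs))"
      using v1 v2 by (auto simp: supported_def cell image_iff) (metis le_add_diff_inverse not_less less_diff_conv2 add.commute)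
    show "\<forall>i<cells_size (cell # cs). i \<in> sources (concat (map2 children (p # L) (cell # cs))) \<longrightarrow>
      (diag_block_mat (map butterfly (p # L)) *\<^sub>v (v1 @\<^sub>v v2)) $ i = w $ i"
    proof (intro allI impI)
      fix i assume i: "i < cells_size (cell # cs)" "i \<in> sources (concat (map2 children (p # L) (cell # cs)))"
      have "i \<in> sources (children p cell) \<or> i \<in> (+) m ` sources (concat (map2 children L cs))"
        using i(2) by (simp add: sources_append size_ch)
      then show "(diag_block_mat (map butterfly (p # L)) *\<^sub>v (v1 @\<^sub>v v2)) $ i = w $ i"
      proof
        assume "i \<in> sources (children p cell)"
        then show ?thesis
          unfolding mult using children_lt[of i] w1[of i] carrier_matD(1)[OF B] by simp
      next
        assume "i \<in> (+) m ` sources (concat (map2 children L cs))"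
        then obtain j where j: "i = m + j" "j \<in> sources (concat (map2 children L cs))" by blast
        then have "j < ?k" using i(1) by (simp add: cell)
        then show ?thesis
          unfolding mult using j w2[of j] carrier_matD(1)[OF B] carrier_matD(1)[OF D] by simp
      qed
    qed
  qed
qed

section \<open>Routing through all layers\<close>

text \<open>
  The invariant of the routing. In a semi-Parker layer it yields \<open>good_cell\<close>: all blocks but the
  last have \<open>\<nu> = 0\<close> or size \<open>1\<close>, where \<open>c < 1\<close>, and the last one has \<open>c = 0\<close>.
\<close>
definition layer_state :: "(nat \<times> nat) list \<Rightarrow> cell list \<Rightarrow> bool" where
  "layer_state L cs \<longleftrightarrow> map fst cs = map butterfly_size L \<and>
     (\<forall>(m, c, I)\<in>set cs. c < m \<and> I \<subseteq> {..<m}) \<and> (cs \<noteq> [] \<longrightarrow> fst (snd (last cs)) = 0)"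

lemma layer_state_good:
  assumes inv: "layer_state L cs" and parker: "\<And>b. b \<in> set (butlast L) \<Longrightarrow> parker b"
  shows "list_all2 good_cell L cs"
proof (rule list_all2_all_nthI)
  have sizes: "map fst cs = map butterfly_size L" using inv by (simp add: layer_state_def)
  then show len: "length L = length cs" by (metis length_map)
  fix i assume i: "i < length L"
  obtain m c I where cell: "cs ! i = (m, c, I)" by (metis prod.exhaust)
  have "cs ! i \<in> set cs" using i len by simp
  then have cI: "c < m" "I \<subseteq> {..<m}" using inv cell by (auto simp: layer_state_def)
  have m: "m = butterfly_size (L ! i)"
    using arg_cong[OF sizes, of "\<lambda>xs. xs ! i"] i len cell by simp
  have "snd (L ! i) = 0 \<or> c = 0"
  proof (cases "Suc i = length L")
    case True
    then have "last cs = cs ! i" using len by (metis diff_Suc_1 last_conv_nth length_0_conv nat.distinct(1))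
    moreover have "cs \<noteq> []" using i len by auto
    ultimately show ?thesis using inv cell by (simp add: layer_state_def)
  next
    case False
    then have "i < length (butlast L)" using i by simp
    then have "L ! i \<in> set (butlast L)" by (metis nth_butlast nth_mem)
    then have "parker (L ! i)" by (rule parker)
    then show ?thesis using cI(1) m by (cases "L ! i") (auto simp: parker_def butterfly_size_def)
  qed
  then show "good_cell (L ! i) (cs ! i)" using cI m cell by (simp add: good_cell_def)
qed

lemma child_bounds:
  assumes "good_cell p cell" "d \<in> set (children p cell)"
  shows "fst (snd d) < fst d \<and> snd (snd d) \<subseteq> {..<fst d}"
  using assms by (cases p; cases cell) (auto simp: children_def good_cell_def butterfly_size_def Let_def split: if_splits)

text \<open>
  If \<open>\<mu> > 0\<close>, then the last child is the second one, with start \<open>c = 0\<close>. If \<open>\<mu> = 0\<close>, it is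
  the first one, whose start \<open>card I2\<close> is \<open>0\<close> as the second half is empty.
\<close>
lemma last_children:
  assumes "good_cell p (m, 0, I)" "0 < m"
  shows "children p (m, 0, I) \<noteq> []" "fst (snd (last (children p (m, 0, I)))) = 0"
proof -
  obtain \<mu> \<nu> where p: "p = (\<mu>, \<nu>)" by (cases p)
  have m: "m = 2 * \<mu> + \<nu>" and I: "I \<subseteq> {..<2 * \<mu> + \<nu>}"
    using assms by (auto simp: p good_cell_def butterfly_size_def)
  have "{i. i + (\<mu> + \<nu>) \<in> I} = {}" if "\<mu> = 0" using I that by auto
  then have empty: "\<mu> = 0 \<Longrightarrow> card {i. i + (\<mu> + \<nu>) \<in> I} = 0" by (metis card.empty)
  have "\<mu> + \<nu> \<noteq> 0" using assms(2) m by simp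
  then have eq: "children p (m, 0, I) = (\<mu> + \<nu>, card {i. i + (\<mu> + \<nu>) \<in> I} mod (\<mu> + \<nu>), I \<inter> {..<\<mu> + \<nu>}) #
      (if \<mu> = 0 then [] else [(\<mu>, 0, {i. i + (\<mu> + \<nu>) \<in> I})])"
    by (simp add: p children_def Let_def)
  show "children p (m, 0, I) \<noteq> []" by (simp add: eq)
  show "fst (snd (last (children p (m, 0, I)))) = 0"
    unfolding eq using empty by (cases "\<mu> = 0") simp_all
qed

lemma next_layer_sizes:
  assumes "list_all2 good_cell L cs"
  shows "map fst (concat (map2 children L cs)) = concat (map child_sizes L)"
  using assms by (induction rule: list_all2_induct) (auto simp: good_cell_def sizes_children)

lemma next_layer_targets:
  assumes "list_all2 good_cell L cs"
  shows "targets (concat (map2 children L cs)) = targets cs"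
  using assms
proof (induction rule: list_all2_induct)
  case (Cons p L cell cs)
  have "cells_size (children p cell) = fst cell"
    using Cons.hyps(1) by (simp add: sizes_children good_cell_def sum_child_sizes)
  then show ?case
    using Cons by (cases cell) (simp add: targets_append targets_children)
qed simp

lemma next_layer_size:
  assumes "list_all2 good_cell L cs"
  shows "cells_size (concat (map2 children L cs)) = cells_size cs"
  using assms
  by (induction rule: list_all2_induct) (auto simp: sizes_children good_cell_def sum_child_sizes)

lemma layer_state_next:
  assumes inv: "layer_state L cs" and good: "list_all2 good_cell L cs"
    and L': "map butterfly_size L' = concat (map child_sizes L)"
  shows "layer_state L' (concat (map2 children L cs))"
  unfolding layer_state_def
proof (intro conjI impI)
  show "map fst (concat (map2 children L cs)) = map butterfly_size L'"
    using next_layer_sizes[OF good] L' by simp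
  have "fst (snd d) < fst d \<and> snd (snd d) \<subseteq> {..<fst d}" if d: "d \<in> set (concat (map2 children L cs))" for d
  proof -
    obtain p cell where "(p, cell) \<in> set (zip L cs)" "d \<in> set (children p cell)" using d by auto
    moreover from this(1) have "good_cell p cell" using good by (auto simp: list_all2_iff)
    ultimately show ?thesis using child_bounds by blast
  qed
  then show "\<forall>(m, c, I)\<in>set (concat (map2 children L cs)). c < m \<and> I \<subseteq> {..<m}" by fastforce
  assume "concat (map2 children L cs) \<noteq> []"
  then have "L \<noteq> []" by auto
  then obtain L0 p where L: "L = L0 @ [p]" by (metis append_butlast_last_id)
  then obtain cs0 cell where cs: "cs = cs0 @ [cell]" "length cs0 = length L0" and pc: "good_cell p cell"
    using good by (auto simp: list_all2_append1 list_all2_Cons1 dest: list_all2_lengthD)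
  obtain m I where cell: "cell = (m, 0, I)" "0 < m"
    using inv cs by (cases cell) (auto simp: layer_state_def)
  have "concat (map2 children L cs) = concat (map2 children L0 cs0) @ children p cell"
    using cs L by simp
  then show "fst (snd (last (concat (map2 children L cs)))) = 0"
    using last_children pc cell by simp
qed

lemma sum_concat_child_sizes:
  "sum_list (concat (map child_sizes L)) = sum_list (map butterfly_size L)"
  by (induction L) (simp_all add: sum_child_sizes)

lemma layout_sizes:
  assumes "rbt_layout n Ls" "l < length Ls"
  shows "sum_list (map butterfly_size (Ls ! l)) = n"
  using assms(2)
proof (induction l)
  case 0
  then show ?case using assms(1) by (simp add: rbt_layout_def hd_conv_nth)
next
  case (Suc l)
  then have "map butterfly_size (Ls ! Suc l) = concat (map child_sizes (Ls ! l))"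
    using assms(1) by (simp add: rbt_layout_def)
  then have "sum_list (map butterfly_size (Ls ! Suc l)) = sum_list (map butterfly_size (Ls ! l))"
    by (simp add: sum_concat_child_sizes)
  then show ?case using Suc by simp
qed

lemma layer_carrier:
  assumes "rbt_layout n Ls" "l < length Ls"
  shows "diag_block_mat (map butterfly (Ls ! l)) \<in> carrier_mat n n"
  using diag_block_butterfly_carrier[of "Ls ! l"] layout_sizes[OF assms] by simp

lemma rbt_prod_carrier:
  assumes "rbt_layout n Ls" "l \<le> length Ls"
  shows "rbt_prod n Ls r l \<in> carrier_mat n n"
  using assms(2)
proof (induction l)
  case (Suc l)
  then show ?case using layer_carrier[OF assms(1), of l]
    by (auto intro!: mult_carrier_mat[of _ n n])
qed simp

lemma rbt_prod_cong:
  "(\<And>i. i < l \<Longrightarrow> r i = r' i) \<Longrightarrow> rbt_prod n Ls r l = rbt_prod n Ls r' l"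
  by (induction l) auto

lemma mat_diag_mult_vec:
  "v \<in> carrier_vec n \<Longrightarrow> mat_diag n f *\<^sub>v v = vec n (\<lambda>i. f i * v $ i)" for v :: "'a::semiring_0 vec"
proof (rule eq_vecI)
  fix i assume v: "v \<in> carrier_vec n" and "i < dim_vec (vec n (\<lambda>i. f i * v $ i))"
  then have i: "i < n" by simp
  have "(mat_diag n f *\<^sub>v v) $ i = (\<Sum>j\<in>{0..<n}. (if i = j then f j else 0) * v $ j)"
    using v i by (simp add: mat_diag_def scalar_prod_def)
  also have "\<dots> = (\<Sum>j\<in>{0..<n}. if i = j then f i * v $ i else 0)"
    by (intro sum.cong) auto
  finally show "(mat_diag n f *\<^sub>v v) $ i = vec n (\<lambda>i. f i * v $ i) $ i" using i by simp
qed (simp add: mat_diag_def)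

text \<open>
  A 0/1 diagonal matrix after the layer deletes everything outside the prescribed positions, so partial
  agreement becomes equality.
\<close>
lemma carries_next_layer:
  fixes P :: "'a::real_field mat"
  assumes good: "list_all2 good_cell L cs" and n: "cells_size cs = n"
    and P: "P \<in> carrier_mat n n" and carries: "carries n P S (sources cs)"
  defines "T \<equiv> sources (concat (map2 children L cs))"
  shows "carries n (mat_diag n (\<lambda>j. of_real (if j \<in> T then 1 else 0)) * (diag_block_mat (map butterfly L) * P)) S T"
  unfolding carries_def
proof
  let ?D = "diag_block_mat (map butterfly L) :: 'a mat"
  let ?R = "mat_diag n (\<lambda>j. of_real (if j \<in> T then 1 else 0)) :: 'a mat"
  fix w :: "'a vec" assume w: "w \<in> supported n T"
  obtain v where v: "v \<in> supported n (sources cs)" and Dv: "\<And>i. i < n \<Longrightarrow> i \<in> T \<Longrightarrow> (?D *\<^sub>v v) $ i = w $ i"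
    using layer_solve[OF good, of w] unfolding n T_def by blast
  obtain u where u: "u \<in> supported n S" "P *\<^sub>v u = v" using carries v unfolding carries_def by blast
  have "n = sum_list (map butterfly_size L)"
    using good n by (induction arbitrary: n rule: list_all2_induct) (auto simp: good_cell_def)
  then have D: "?D \<in> carrier_mat n n" using diag_block_butterfly_carrier[of L] by simp
  have car: "u \<in> carrier_vec n" "v \<in> carrier_vec n" using u v by (auto simp: supported_def)
  have R: "?R \<in> carrier_mat n n" by simp
  have "(?R * (?D * P)) *\<^sub>v u = ?R *\<^sub>v (?D *\<^sub>v v)"
    using assoc_mult_mat_vec[OF R mult_carrier_mat[OF D P] car(1)] assoc_mult_mat_vec[OF D P car(1)] u(2) by simp
  also have "\<dots> = w"
  proof (rule eq_vecI)
    fix i assume "i < dim_vec w"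
    then have "i < n" using w by (auto simp: supported_def)
    then show "(?R *\<^sub>v (?D *\<^sub>v v)) $ i = w $ i"
      using mat_diag_mult_vec[OF mult_mat_vec_carrier[OF D car(2)], of "\<lambda>j. of_real (if j \<in> T then 1 else 0)"] Dv w
      by (auto simp: supported_def)
  qed (use w in \<open>auto simp: supported_def mat_diag_def\<close>)
  finally show "\<exists>u\<in>supported n S. ?R * (?D * P) *\<^sub>v u = w" using u by blast
qed

text \<open>
  The diagonal factor of layer \<open>l + 1\<close> is included, but not its butterflies: it is this factor that
  deletes the unwanted outputs of layer \<open>l\<close>. The first diagonal factor is the identity.
\<close>
lemma rbt_prod_carries:
  assumes n: "n \<ge> 1" and layout: "rbt_layout n Ls" and semi: "semi_parker Ls" and I: "I \<subseteq> {..<n}"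
    and "l < length Ls"
  shows "\<exists>r cs. layer_state (Ls ! l) cs \<and> targets cs = I \<and> cells_size cs = n \<and>
    carries n (mat_diag n (\<lambda>j. of_real (r l j)) * rbt_prod n Ls r l :: 'a::real_field mat) {..<card I} (sources cs)"
  using \<open>l < length Ls\<close>
proof (induction l)
  case 0
  have card: "card I \<le> n" using card_mono[OF _ I] by simp
  have "map butterfly_size (Ls ! 0) = [n]"
    using layout by (auto simp: rbt_layout_def hd_conv_nth)
  then have "layer_state (Ls ! 0) [(n, 0, I)]"
    using n I by (simp add: layer_state_def)
  moreover have "carries n (1\<^sub>m n :: 'a mat) {..<card I} (sources [(n, 0, I)])"
    using card by (auto simp: carries_def cyclic_interval_from_0 supported_def)
  ultimately show ?case by (intro exI[of _ "\<lambda>_ _. 1"] exI[of _ "[(n, 0, I)]"]) simp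
next
  case (Suc l)
  then obtain r cs where inv: "layer_state (Ls ! l) cs" and targets: "targets cs = I" and size: "cells_size cs = n"
    and carries: "carries n (mat_diag n (\<lambda>j. of_real (r l j)) * rbt_prod n Ls r l :: 'a mat) {..<card I} (sources cs)"
    by auto
  have l: "l < length Ls" using Suc.prems by simp
  have good: "list_all2 good_cell (Ls ! l) cs"
    using inv by (rule layer_state_good) (use semi l in \<open>auto simp: semi_parker_def\<close>)
  define cs' where "cs' = concat (map2 children (Ls ! l) cs)"
  define r' where "r' = r(Suc l := \<lambda>j. if j \<in> sources cs' then 1 else 0)"
  let ?R = "mat_diag n (\<lambda>j. of_real (r l j)) :: 'a mat" and ?P = "rbt_prod n Ls r l :: 'a mat"
  let ?D = "diag_block_mat (map butterfly (Ls ! l)) :: 'a mat"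
  have P: "?P \<in> carrier_mat n n" by (rule rbt_prod_carrier[OF layout less_imp_le[OF l]])
  have D: "?D \<in> carrier_mat n n" using layer_carrier[OF layout l] .
  have R: "?R \<in> carrier_mat n n" by simp
  have "rbt_prod n Ls r' l = ?P" by (rule rbt_prod_cong) (simp add: r'_def)
  then have prod: "rbt_prod n Ls r' (Suc l) = ?D * (?R * ?P)"
    using assoc_mult_mat[OF D R P] by (simp add: r'_def)
  have "carries n (mat_diag n (\<lambda>j. of_real (r' (Suc l) j)) * (?D * (?R * ?P))) {..<card I} (sources cs')"
    using carries_next_layer[OF good size mult_carrier_mat[OF R P] carries] by (simp add: r'_def cs'_def)
  moreover have "layer_state (Ls ! Suc l) cs'"
    unfolding cs'_def using layer_state_next[OF inv good] layout Suc.prems by (simp add: rbt_layout_def)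
  moreover have "targets cs' = I" "cells_size cs' = n"
    using next_layer_targets[OF good] next_layer_size[OF good] targets size by (simp_all add: cs'_def)
  ultimately show ?case unfolding prod[symmetric] by blast
qed

text \<open>
  In a block of size \<open>1\<close> the cyclic interval of length \<open>card I\<close> is \<open>I\<close>.
\<close>
lemma sources_eq_targets:
  assumes "\<And>m c I. (m, c, I) \<in> set cs \<Longrightarrow> m = 1 \<and> I \<subseteq> {..<1}"
  shows "sources cs = targets cs"
  using assms
proof (induction cs rule: sources.induct)
  case (2 m c I cs)
  have "m = 1" "I \<subseteq> {0}" using "2.prems"[of m c I] by auto
  then have "cyclic_interval m c (card I) = I"
    by (auto simp: cyclic_interval_def subset_singleton_iff)
  moreover have "sources cs = targets cs" using "2.prems" by (intro "2.IH") auto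
  ultimately show ?case by simp
qed simp

lemma butterfly_layer_size_1:
  assumes "\<And>b. b \<in> set L \<Longrightarrow> butterfly_size b = 1"
  shows "diag_block_mat (map butterfly L) = (1\<^sub>m (length L) :: 'a::real_field mat)"
  using assms
proof (induction L)
  case (Cons b L)
  obtain \<mu> \<nu> where b: "b = (\<mu>, \<nu>)" by (cases b)
  then have "2 * \<mu> + \<nu> = 1" using Cons.prems[of b] by (simp add: butterfly_size_def)
  then have "\<mu> = 0 \<and> \<nu> = 1" by presburger
  with b have "b = (0, 1)" by simp
  then have "butterfly b = (1\<^sub>m 1 :: 'a mat)" by (auto simp: butterfly_def)
  then show ?case using Cons by (simp add: Let_def four_block_one_mat)
qed auto

lemma rbt_carries:
  assumes n: "n \<ge> 1" and layout: "rbt_layout n Ls" and semi: "semi_parker Ls" and full: "full_depth Ls"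
    and I: "I \<subseteq> {..<n}"
  shows "\<exists>r. carries n (rbt n Ls r :: 'a::real_field mat) {..<card I} I"
proof -
  have "Ls \<noteq> []" using layout by (simp add: rbt_layout_def)
  then obtain l where l: "length Ls = Suc l" by (metis length_0_conv not0_implies_Suc)
  then have last: "last Ls = Ls ! l" using \<open>Ls \<noteq> []\<close> by (simp add: last_conv_nth)
  obtain r cs where inv: "layer_state (Ls ! l) cs" and targets: "targets cs = I"
    and carries: "carries n (mat_diag n (\<lambda>j. of_real (r l j)) * rbt_prod n Ls r l :: 'a mat) {..<card I} (sources cs)"
    using rbt_prod_carries[OF n layout semi I, of l] l by auto
  have one: "butterfly_size b = 1" if "b \<in> set (Ls ! l)" for b
    using full that by (simp add: full_depth_def last)
  have "sources cs = I"
    unfolding targets[symmetric]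
  proof (rule sources_eq_targets)
    fix m c I assume cell: "(m, c, I) \<in> set cs"
    have "fst ` set cs = butterfly_size ` set (Ls ! l)"
      using inv by (metis layer_state_def list.set_map)
    then have "m = 1" using cell one by (metis (no_types, lifting) fst_conv imageE image_eqI)
    then show "m = 1 \<and> I \<subseteq> {..<1}" using cell inv by (auto simp: layer_state_def)
  qed
  moreover have "length (Ls ! l) = n"
  proof -
    have "map butterfly_size (Ls ! l) = map (\<lambda>_. 1) (Ls ! l)" using one by simp
    then have "sum_list (map butterfly_size (Ls ! l)) = length (Ls ! l)"
      by (metis mult.right_neutral of_nat_id sum_list_triv)
    then show ?thesis using layout_sizes[OF layout, of l] l by simp
  qed
  then have D: "diag_block_mat (map butterfly (Ls ! l)) = (1\<^sub>m n :: 'a mat)"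
    using butterfly_layer_size_1[of "Ls ! l"] one by simp
  have "(rbt n Ls r :: 'a mat) = mat_diag n (\<lambda>j. of_real (r l j)) * rbt_prod n Ls r l"
    using left_mult_one_mat[of "mat_diag n (\<lambda>j. of_real (r l j)) :: 'a mat" n n] by (simp add: rbt_def l D)
  ultimately show ?thesis using carries by (intro exI[of _ r]) simp
qed


section \<open>Leading minors as polynomials in the diagonal entries\<close>

text \<open>
  The carrier is required for all arguments, so that products of such matrices have the usual entries.
\<close>
definition polynomial_mat :: "'i set \<Rightarrow> nat \<Rightarrow> (('i \<Rightarrow> real) \<Rightarrow> 'a::real_normed_field mat) \<Rightarrow> bool" where
  "polynomial_mat K n F \<longleftrightarrow> (\<forall>x. F x \<in> carrier_mat n n) \<and>
     (\<forall>i<n. \<forall>j<n. polynomial_in K (\<lambda>x. F x $$ (i, j)))"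

lemma polynomial_mat_const: "A \<in> carrier_mat n n \<Longrightarrow> polynomial_mat K n (\<lambda>x. A)"
  by (simp add: polynomial_mat_def polynomial_in.const)

lemma polynomial_mat_transpose: "polynomial_mat K n F \<Longrightarrow> polynomial_mat K n (\<lambda>x. (F x)\<^sup>T)"
proof -
  assume F: "polynomial_mat K n F"
  then have "(F x)\<^sup>T $$ (i, j) = F x $$ (j, i)" if "i < n" "j < n" for x i j
    using that by (metis carrier_matD index_transpose_mat(1) polynomial_mat_def)
  with F show ?thesis by (simp add: polynomial_mat_def)
qed

lemma polynomial_mat_mult:
  assumes F: "polynomial_mat K n F" and G: "polynomial_mat K n G"
  shows "polynomial_mat K n (\<lambda>x. F x * G x)"
  unfolding polynomial_mat_def
proof (intro conjI allI impI)
  have car: "F x \<in> carrier_mat n n" "G x \<in> carrier_mat n n" for x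
    using F G by (simp_all add: polynomial_mat_def)
  then show "F x * G x \<in> carrier_mat n n" for x by (rule mult_carrier_mat)
  fix i j assume ij: "i < n" "j < n"
  have "(F x * G x) $$ (i, j) = (\<Sum>k\<in>{0..<n}. F x $$ (i, k) * G x $$ (k, j))" for x
    using ij carrier_matD[OF car(1)[of x]] carrier_matD[OF car(2)[of x]] by (simp add: scalar_prod_def)
  moreover have "polynomial_in K (\<lambda>x. \<Sum>k\<in>{0..<n}. F x $$ (i, k) * G x $$ (k, j))"
    using F G ij by (intro polynomial_in_sum polynomial_in.mult) (simp_all add: polynomial_mat_def)
  ultimately show "polynomial_in K (\<lambda>x. (F x * G x) $$ (i, j))" by simp
qed

lemma polynomial_mat_diag:
  assumes "\<And>j. j < n \<Longrightarrow> polynomial_in K (\<lambda>x. f x j)"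
  shows "polynomial_mat K n (\<lambda>x. mat_diag n (f x))"
proof -
  have "polynomial_in K (\<lambda>x. if i = j then f x j else 0)" if "j < n" for i j
    using assms[OF that] by (cases "i = j") (simp_all add: polynomial_in.const)
  then show ?thesis by (simp add: polynomial_mat_def mat_diag_def)
qed

lemma polynomial_in_leading_minor:
  assumes F: "polynomial_mat K n F" and k: "k \<le> n"
  shows "polynomial_in K (\<lambda>x. det (Matrix.mat k k (\<lambda>(i, j). F x $$ (i, j))))"
proof -
  have "det (Matrix.mat k k (\<lambda>(i, j). F x $$ (i, j))) =
      (\<Sum>p\<in>{p. p permutes {0..<k}}. signof p * (\<Prod>i\<in>{0..<k}. F x $$ (i, p i)))" for x
  proof -
    have "(\<Prod>i = 0..<k. Matrix.mat k k (\<lambda>(i, j). F x $$ (i, j)) $$ (i, p i)) = (\<Prod>i\<in>{0..<k}. F x $$ (i, p i))"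
      if "p permutes {0..<k}" for p
    proof (rule prod.cong)
      fix i assume "i \<in> {0..<k}"
      moreover from this have "p i < k" using permutes_in_image[OF that] by simp
      ultimately show "Matrix.mat k k (\<lambda>(i, j). F x $$ (i, j)) $$ (i, p i) = F x $$ (i, p i)" by simp
    qed simp
    then show ?thesis by (subst det_def'[of _ k]) (auto intro!: sum.cong)
  qed
  moreover have "polynomial_in K (\<lambda>x. \<Sum>p\<in>{p. p permutes {0..<k}}. signof p * (\<Prod>i\<in>{0..<k}. F x $$ (i, p i)))"
  proof (intro polynomial_in_sum polynomial_in.mult polynomial_in_prod)
    fix p i assume "p \<in> {p. p permutes {0..<k}}" "i \<in> {0..<k}"
    then have "i < k" "p i < k" using permutes_in_image[of p "{0..<k}" i] by simp_all
    then show "polynomial_in K (\<lambda>x. F x $$ (i, p i))" using F k by (simp add: polynomial_mat_def)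
  qed (rule polynomial_in.const)
  ultimately show ?thesis by simp
qed

lemma polynomial_mat_rbt:
  assumes layout: "rbt_layout n Ls" and K: "\<And>i j. i < length Ls \<Longrightarrow> j < n \<Longrightarrow> (b, i, j) \<in> K"
  shows "polynomial_mat K n (\<lambda>x. rbt n Ls (\<lambda>i j. x (b, i, j)) :: 'a::real_normed_field mat)"
proof -
  have "polynomial_mat K n (\<lambda>x. rbt_prod n Ls (\<lambda>i j. x (b, i, j)) l :: 'a mat)" if "l \<le> length Ls" for l
    using that
  proof (induction l)
    case 0
    then show ?case by (simp add: polynomial_mat_const)
  next
    case (Suc l)
    have "polynomial_mat K n (\<lambda>x. mat_diag n (\<lambda>j. of_real (x (b, l, j))) :: 'a mat)"
      using Suc.prems by (intro polynomial_mat_diag polynomial_in.coord K) auto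
    then show ?case
      using Suc layer_carrier[OF layout, of l] by (auto intro!: polynomial_mat_mult polynomial_mat_const)
  qed
  then show ?thesis by (simp add: rbt_def)
qed


section \<open>Strong nonsingularity\<close>

lemma exists_nonzero_leading_minor:
  fixes A :: "'a::real_field mat"
  assumes n: "n \<ge> 1" and A: "A \<in> carrier_mat n n" and det: "det A \<noteq> 0" and k: "k \<le> n"
    and LU: "rbt_layout n LU" "semi_parker LU" "full_depth LU"
    and LV: "rbt_layout n LV" "semi_parker LV" "full_depth LV"
  shows "\<exists>r s. det (Matrix.mat k k (\<lambda>(i, j). ((rbt n LU r)\<^sup>T * A * rbt n LV s) $$ (i, j))) \<noteq> 0"
proof -
  obtain f g where f: "inj_on f {..<k}" "f ` {..<k} \<subseteq> {..<n}" and g: "inj_on g {..<k}" "g ` {..<k} \<subseteq> {..<n}"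
    and minor: "det (Matrix.mat k k (\<lambda>(i, j). A $$ (f i, g j))) \<noteq> 0"
    using exists_nonzero_minor[OF A det k] by blast
  have card: "card (f ` {..<k}) = k" "card (g ` {..<k}) = k"
    using f(1) g(1) by (simp_all add: card_image)
  obtain r where r: "carries n (rbt n LU r :: 'a mat) {..<k} (f ` {..<k})"
    using rbt_carries[OF n LU f(2)] card by auto
  obtain s where s: "carries n (rbt n LV s :: 'a mat) {..<k} (g ` {..<k})"
    using rbt_carries[OF n LV g(2)] card by auto
  have "rbt n LU r \<in> carrier_mat n n" "rbt n LV s \<in> carrier_mat n n"
    unfolding rbt_def using LU(1) LV(1) by (auto intro: rbt_prod_carrier)
  then show ?thesis using leading_minor_nonzero[OF A _ _ k f(2) g(2) minor r s] by blast
qed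

(* Up to isomorphism, the instances of the class constraint on 'a are real and complex.
   Layers and positions are indexed from 0: r i j and s i j are the random diagonal
   entries of the left and right transform in layer i + 1 at position j + 1. *)
theorem theorem3:
  fixes A :: "'a::{real_normed_field, euclidean_space} mat"
    and n d :: nat
    and LU LV :: "(nat \<times> nat) list list"
    and M :: "'w measure"
    and r s :: "nat \<Rightarrow> nat \<Rightarrow> 'w \<Rightarrow> real"
  assumes "n \<ge> 1"
    and "A \<in> carrier_mat n n" and "invertible_mat A"
    and "d = nat \<lceil>log 2 (real n)\<rceil> + 1"
    and "rbt_layout n LU" and "length LU = d" and "semi_parker LU" and "full_depth LU"
    and "rbt_layout n LV" and "length LV = d" and "semi_parker LV" and "full_depth LV"
    and "prob_space M"
    and "prob_space.indep_vars M (\<lambda>_. borel)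
           (\<lambda>(is_left, i, j). if is_left then r i j else s i j)
           ((UNIV :: bool set) \<times> {..<d} \<times> {..<n})"
    and "\<And>i j x. i < d \<Longrightarrow> j < n \<Longrightarrow> measure M {\<omega> \<in> space M. r i j \<omega> = x} = 0"
    and "\<And>i j x. i < d \<Longrightarrow> j < n \<Longrightarrow> measure M {\<omega> \<in> space M. s i j \<omega> = x} = 0"
  shows "AE \<omega> in M. strongly_nonsingular
           (transpose_mat (rbt n LU (\<lambda>i j. r i j \<omega>)) * A * rbt n LV (\<lambda>i j. s i j \<omega>))"
proof -
  interpret prob_space M by fact
  let ?K = "(UNIV :: bool set) \<times> {..<d} \<times> {..<n}"
  define X where "X = (\<lambda>(is_left, i, j). if is_left then r i j else s i j)"
  define F where "F = (\<lambda>x. (rbt n LU (\<lambda>i j. x (True, i, j)))\<^sup>T * A * rbt n LV (\<lambda>i j. x (False, i, j)))"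
  define minor where "minor = (\<lambda>k x. det (Matrix.mat k k (\<lambda>(i, j). F x $$ (i, j))))"
  have F: "polynomial_mat ?K n F"
    unfolding F_def using assms(2,5,6,9,10)
    by (intro polynomial_mat_mult polynomial_mat_transpose polynomial_mat_const polynomial_mat_rbt) auto
  have "AE \<omega> in M. minor k (\<lambda>i. X i \<omega>) \<noteq> 0" if k: "k \<le> n" for k
  proof -
    have "det A \<noteq> 0" using assms(2,3) invertible_mat_iff_det by blast
    then obtain r0 s0 where "det (Matrix.mat k k (\<lambda>(i, j). ((rbt n LU r0)\<^sup>T * A * rbt n LV s0) $$ (i, j))) \<noteq> 0"
      using exists_nonzero_leading_minor[OF assms(1,2) _ k assms(5,7,8,9,11,12)] by blast
    then have nonzero: "minor k (\<lambda>(b, i, j). if b then r0 i j else s0 i j) \<noteq> 0"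
      by (simp add: minor_def F_def)
    show ?thesis
    proof (rule AE_polynomial_nonzero[where f = "minor k" and X = X and K = ?K, OF _ _ _ _ nonzero])
      show "indep_vars (\<lambda>_. borel) X ?K" unfolding X_def by fact
      show "polynomial_in ?K (minor k)"
        unfolding minor_def by (rule polynomial_in_leading_minor[OF F k])
      show "prob {\<omega> \<in> space M. X i \<omega> = t} = 0" if "i \<in> ?K" for i t
        using that assms(15,16) by (cases i) (auto simp: X_def)
    qed simp
  qed
  then have "AE \<omega> in M. \<forall>k\<in>{1..n}. minor k (\<lambda>i. X i \<omega>) \<noteq> 0"
    by (intro AE_finite_allI) auto
  then show ?thesis
  proof (rule AE_mp, intro AE_I2 impI)
    fix \<omega> assume nonzero: "\<forall>k\<in>{1..n}. minor k (\<lambda>i. X i \<omega>) \<noteq> 0"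
    let ?B = "F (\<lambda>i. X i \<omega>)"
    have B: "?B \<in> carrier_mat n n" using F by (simp add: polynomial_mat_def)
    have "invertible_mat (submatrix ?B {..<k} {..<k})" if "k \<in> {1..n}" for k
      using nonzero that submatrix_leading[OF B, of k] invertible_mat_iff_det[of "submatrix ?B {..<k} {..<k}" k]
      by (simp add: minor_def)
    then have "strongly_nonsingular ?B"
      using B by (auto simp: strongly_nonsingular_def)
    then show "strongly_nonsingular (transpose_mat (rbt n LU (\<lambda>i j. r i j \<omega>)) * A * rbt n LV (\<lambda>i j. s i j \<omega>))"
      by (simp add: F_def X_def)
  qed
qed

end
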